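(* Let $n\ge3$ and let $K$ be a $C^1$ function on $\mathbb S^n$ such that $\nabla_{\frac{\partial}{\partial\theta_{n+1}}}K\ge0$ and is not identically zero on $\mathbb S^n\setminus\{\mathbf n,\mathbf s\}$. If $v\in C^2(\mathbb S^n\setminus\{\mathbf n\})$ is a solution of $$-\mathcal L_{\mathbb S^n}v=K(\theta)v^{(n+2)/(n-2)}\quad\text{and}\quad v>0\quad\text{on }\mathbb S^n\setminus\{\mathbf n\}\qquad( * )$$ satisfying $\liminf_{\theta\to\mathbf n}v(\theta)>0$, then $$v(\theta)\ge C_0\,d(\theta,\mathbf n)^{-(n-2)/2}\quad\text{for all }\theta\in\mathbb S^n\setminus\{\mathbf n\}$$ for some positive constant $C_0$. In particular, $( * )$ has no $C^2(\mathbb S^n)$ solutions.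
   Context: $\mathbb S^n\subset\mathbb R^{n+1}$ is the unit sphere with its standard metric, points written $\theta=(\theta_1,\dots,\theta_{n+1})$; $\mathbf n=(0,\dots,0,1)$, $\mathbf s=(0,\dots,0,-1)$; $d$ is the geodesic distance on $\mathbb S^n$; $\mathcal L_{\mathbb S^n}:=\Delta_{\mathbb S^n}-\frac{n(n-2)}4$ with $\Delta_{\mathbb S^n}$ the Laplace–Beltrami operator. $\nabla_X$ is covariant differentiation with respect to the vector field $X$, and $\nabla_{\frac{\partial}{\partial\theta_{n+1}}}K$ denotes the derivative of $K$ along the meridians in the direction of increasing $\theta_{n+1}$. Thus the conditions on $K$ mean: in geodesic polar coordinates $(r,\omega)$, $0<r<\pi$, $\omega\in\mathbb S^{n-1}$, centered at $\mathbf s$, the function $r\mapsto K(r,\omega)$ is non-decreasing on $(0,\pi)$ for each fixed $\omega$, and $K$ is non-constant. *)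

theory Defs
  imports "HOL-Analysis.Analysis"
begin

abbreviation unit_sphere :: "'a::euclidean_space set" where
  "unit_sphere \<equiv> sphere 0 1"

(* Orthogonal projection of h onto the tangent space {h. inner p h = 0} at a point p of the sphere. *)
definition tproj :: "'a::euclidean_space \<Rightarrow> 'a \<Rightarrow> 'a" where
  "tproj p h = h - (p \<bullet> h) *\<^sub>R p"

(* Differential at p of a map defined on the sphere, extended by 0 to the normal line.
   A derivative relative to the sphere is determined only on tangent vectors; the
   condition D p = 0 selects a unique extension to the ambient space
   (sphere_deriv_unique, sphere_deriv_eq). Only values of f on the sphere near p matter. *)
definition sphere_deriv ::
    "('a::euclidean_space \<Rightarrow> 'b::real_normed_vector) \<Rightarrow> 'a \<Rightarrow> 'a \<Rightarrow> 'b" where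
  "sphere_deriv f p = (THE D. (f has_derivative D) (at p within unit_sphere) \<and> D p = 0)"

lemma sphere_curve_deriv:
  fixes f :: "'a::euclidean_space \<Rightarrow> 'b::real_normed_vector"
  assumes p: "norm p = 1" and h: "norm h = 1" "p \<bullet> h = 0"
    and D: "(f has_derivative D) (at p within unit_sphere)"
  shows "((\<lambda>t. f (cos t *\<^sub>R p + sin t *\<^sub>R h)) has_vector_derivative D h) (at 0)"
proof -
  let ?c = "\<lambda>t. cos t *\<^sub>R p + sin t *\<^sub>R h"
  have img: "range ?c \<subseteq> unit_sphere"
  proof -
    have "p \<bullet> p = 1" "h \<bullet> h = 1" "h \<bullet> p = 0" using p h by (auto simp: norm_eq_1 inner_commute)
    hence "norm (?c t) = 1" for t
      using h(2) by (simp add: norm_eq_1 inner_add_left inner_add_right flip: power2_eq_square)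
    thus ?thesis by auto
  qed
  have c: "(?c has_derivative (\<lambda>t. t *\<^sub>R h)) (at 0)"
    by (auto intro!: derivative_eq_intros)
  have D': "(f has_derivative D) (at (?c 0) within range ?c)"
    using has_derivative_subset[OF D img] by simp
  have "((f \<circ> ?c) has_derivative (D \<circ> (\<lambda>t. t *\<^sub>R h))) (at 0)"
    by (rule diff_chain_within[OF c D'])
  thus ?thesis unfolding has_vector_derivative_def o_def
    using has_derivative_bounded_linear[OF D] by (simp add: linear_cmul bounded_linear.linear)
qed

lemma sphere_deriv_unique:
  fixes f :: "'a::euclidean_space \<Rightarrow> 'b::real_normed_vector"
  assumes p: "norm p = 1"
    and D: "(f has_derivative D) (at p within unit_sphere)" "D p = 0"
    and E: "(f has_derivative E) (at p within unit_sphere)" "E p = 0"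
  shows "D = E"
proof
  fix h
  have lD: "linear D" "linear E" using D E has_derivative_bounded_linear bounded_linear.linear by blast+
  define k where "k = tproj p h"
  have pk: "p \<bullet> k = 0" using p by (simp add: k_def tproj_def inner_diff_right norm_eq_1)
  have "D k = E k"
  proof (cases "k = 0")
    case True thus ?thesis using lD by (simp add: linear_0)
  next
    case False
    let ?u = "(1 / norm k) *\<^sub>R k"
    have u: "norm ?u = 1" "p \<bullet> ?u = 0" using False pk by auto
    have "D ?u = E ?u"
      using vector_derivative_unique_at sphere_curve_deriv[OF p u D(1)] sphere_curve_deriv[OF p u E(1)] by blast
    thus ?thesis using False lD by (simp add: linear_cmul)
  qed
  moreover have "h = k + (p \<bullet> h) *\<^sub>R p" by (simp add: k_def tproj_def)
  ultimately show "D h = E h" using lD D E by (metis linear_add linear_cmul scaleR_zero_right)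
qed

lemma sphere_deriv_eqI:
  fixes f :: "'a::euclidean_space \<Rightarrow> 'b::real_normed_vector"
  assumes "p \<in> unit_sphere" "(f has_derivative D) (at p within unit_sphere)"  "D p = 0"
  shows "sphere_deriv f p = D"
  unfolding sphere_deriv_def using assms sphere_deriv_unique by (intro the_equality) auto

lemma has_derivative_tproj: assumes "p \<in> unit_sphere"
  shows "((\<lambda>x. x) has_derivative tproj p) (at p within unit_sphere)"
proof -
  define r where "r = (\<lambda>x::'a. x - ((x \<bullet> x - 1) / 2) *\<^sub>R x)"
  have p: "p \<bullet> p = 1" using assms by (simp add: norm_eq_1)
  have "(r has_derivative tproj p) (at p within unit_sphere)"
    unfolding r_def tproj_def
    by (auto intro!: derivative_eq_intros simp: p fun_eq_iff inner_commute)
  thus ?thesis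
    by (rule has_derivative_transform_within[where d=1]) (use assms in \<open>auto simp: r_def norm_eq_1\<close>)
qed

lemma sphere_deriv_eq:
  fixes f :: "'a::euclidean_space \<Rightarrow> 'b::real_normed_vector"
  assumes "p \<in> unit_sphere" "(f has_derivative D) (at p within unit_sphere)"
  shows "sphere_deriv f p = D \<circ> tproj p"
proof (rule sphere_deriv_eqI)
  have "(f has_derivative D) (at ((\<lambda>x. x) p) within (\<lambda>x. x) ` unit_sphere)" using assms by simp
  from diff_chain_within[OF has_derivative_tproj[OF assms(1)] this]
  show "(f has_derivative D \<circ> tproj p) (at p within unit_sphere)" by (simp add: o_def)
  show "(D \<circ> tproj p) p = 0" using assms
    by (simp add: tproj_def linear_0 norm_eq_1 has_derivative_bounded_linear bounded_linear.linear)
qed fact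

(* U is meant to be a relatively open subset of the sphere. *)
definition C1_on_sphere ::
    "'a::euclidean_space set \<Rightarrow> ('a \<Rightarrow> 'b::real_normed_vector) \<Rightarrow> bool" where
  "C1_on_sphere U f \<longleftrightarrow>
     (\<forall>p\<in>U. f differentiable (at p within unit_sphere)) \<and>
     (\<forall>h. continuous_on U (\<lambda>p. sphere_deriv f p h))"

(* The tangent vector representing the differential in the induced metric. *)
definition sphere_grad :: "('a::euclidean_space \<Rightarrow> real) \<Rightarrow> 'a \<Rightarrow> 'a" where
  "sphere_grad f p = (\<Sum>b\<in>Basis. sphere_deriv f p b *\<^sub>R b)"

(* f is C^2 iff it is C^1 and all components of its gradient field are C^1. *)
definition C2_on_sphere :: "'a::euclidean_space set \<Rightarrow> ('a \<Rightarrow> real) \<Rightarrow> bool" where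
  "C2_on_sphere U f \<longleftrightarrow> C1_on_sphere U f \<and> C1_on_sphere U (sphere_grad f)"

(* Levi-Civita connection of the induced metric: the tangential part of the
   derivative in the ambient space. *)
definition sphere_cov_deriv :: "('a::euclidean_space \<Rightarrow> 'a) \<Rightarrow> 'a \<Rightarrow> 'a \<Rightarrow> 'a" where
  "sphere_cov_deriv X p h = tproj p (sphere_deriv X p h)"

(* Trace of h \<mapsto> sphere_cov_deriv X p h over the tangent space. It may be computed in the
   ambient space because this map vanishes on the normal vector p. *)
definition sphere_div :: "('a::euclidean_space \<Rightarrow> 'a) \<Rightarrow> 'a \<Rightarrow> real" where
  "sphere_div X p = (\<Sum>b\<in>Basis. sphere_cov_deriv X p b \<bullet> b)"

definition sphere_laplacian :: "('a::euclidean_space \<Rightarrow> real) \<Rightarrow> 'a \<Rightarrow> real" where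
  "sphere_laplacian f = sphere_div (sphere_grad f)"

definition sphere_dist :: "'a::euclidean_space \<Rightarrow> 'a \<Rightarrow> real" where
  "sphere_dist x y =
     Inf {integral {0..1} (\<lambda>t. norm (vector_derivative \<gamma> (at t))) | \<gamma>.
            \<gamma> C1_differentiable_on {0..1} \<and> path_image \<gamma> \<subseteq> unit_sphere \<and>
            pathstart \<gamma> = x \<and> pathfinish \<gamma> = y}"

(* R^(n+1) is represented as R^n \<times> R, so that the last coordinate theta_(n+1) is snd
   and n = CARD('n). *)
definition north :: "(real^'n) \<times> real" where
  "north = (0, 1)"

definition south :: "(real^'n) \<times> real" where
  "south = (0, -1)"

(* The coordinate field d/d theta_(n+1) away from the poles: tangent to the meridians,
   with derivative of theta_(n+1) along it equal to 1
   (note that |tproj p north|^2 = 1 - (snd p)^2). *)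
definition meridian_field :: "(real^'n) \<times> real \<Rightarrow> (real^'n) \<times> real" where
  "meridian_field p = (1 / (1 - (snd p)\<^sup>2)) *\<^sub>R tproj p north"

definition conf_laplacian :: "((real^'n) \<times> real \<Rightarrow> real) \<Rightarrow> (real^'n) \<times> real \<Rightarrow> real" where
  "conf_laplacian v p =
     sphere_laplacian v p - real CARD('n) * (real CARD('n) - 2) / 4 * v p"

definition solves_on_punctured_sphere ::
    "((real^'n) \<times> real \<Rightarrow> real) \<Rightarrow> ((real^'n) \<times> real \<Rightarrow> real) \<Rightarrow> bool" where
  "solves_on_punctured_sphere K v \<longleftrightarrow>
     (\<forall>p\<in>unit_sphere - {north}.
        v p > 0 \<and>
        - conf_laplacian v p = K p * v p powr ((real CARD('n) + 2) / (real CARD('n) - 2)))"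

end

theory Submission
  imports Defs
begin

text \<open>
Stereographic projection from the north pole turns \<open>v\<close> into a positive function \<open>u\<close> on \<open>n\<close>-dimensional Euclidean space with
\<open>- \<Delta> u = k u powr ((n + 2) / (n - 2))\<close>, where \<open>k\<close>, the function \<open>K\<close> in the new coordinates, is bounded
and non-decreasing along rays. The exponent is the conformally invariant one: the conformal factor
disappears from the equation (\<open>has_laplacian_stereo_pullback\<close>), and the Kelvin transform \<open>u\<^sub>r\<close> of \<open>u\<close>
in the sphere of radius \<open>r\<close> solves the same equation with \<open>k\<close> reflected in that sphere.

The method of moving spheres shows \<open>u\<^sub>r x \<le> u x\<close> for all \<open>r \<ge> 0\<close> and all \<open>x \<noteq> 0\<close> with \<open>|x| \<ge> r\<close>. In this exterior region
reflection only decreases \<open>k\<close>, so \<open>u - u\<^sub>r\<close> is a supersolution of a linear equation. The inequality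
is trivial for \<open>r = 0\<close>, where \<open>u\<^sub>0 = 0\<close>, and it survives limits in \<open>r\<close>. Suppose that it holds for some \<open>r\<close>.
If \<open>u = u\<^sub>r\<close> throughout the exterior, then \<open>k\<close> is invariant under the reflection, hence constant
on rays, which is excluded because \<open>K\<close> varies along some meridian. Otherwise
\<open>u > u\<^sub>r\<close> by the strong minimum principle, and \<open>u - u\<^sub>r \<ge> c |x| powr (2 - n)\<close> far away by a
comparison function at infinity (\<open>positive_supersolution_at_infinity\<close>). This gap absorbs a small increase
of \<open>r\<close> except close to the sphere of reflection, and in that narrow annulus a minimum principle
holds for free (\<open>narrow_annulus\<close>). So the inequality can always be continued
(\<open>above_open\<close>). Since \<open>k\<close> may change sign, \<open>u - u\<^sub>r\<close> need not be superharmonic; this is why each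
minimum principle allows for a zeroth order term.

Taking \<open>r = sqrt |x|\<close> yields \<open>u x \<ge> |x| powr (- (n - 2) / 2) u (x / |x|)\<close>, that is, a lower bound
for \<open>v\<close> by a multiple of the power \<open>- (n - 2) / 2\<close> of the chordal distance from the north pole. Since
the geodesic distance is at least the chordal one, the same bound holds with the geodesic distance. A solution
that is of class \<open>C\<^sup>2\<close> on the whole sphere is bounded, which contradicts the bound.
\<close>

section \<open>The Laplacian along coordinate lines and minimum principles\<close>

text \<open>The Laplacian as the sum of the second derivatives along the coordinate lines through \<open>x\<close>: the
comparison arguments only look at a function along these lines near a minimum.\<close>

definition has_laplacian :: "('a::euclidean_space \<Rightarrow> real) \<Rightarrow> real \<Rightarrow> 'a \<Rightarrow> bool" where
  "has_laplacian f L x \<longleftrightarrow>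
     (\<exists>G H. (\<forall>b\<in>Basis.
          (\<forall>\<^sub>F t in nhds 0. ((\<lambda>s. f (x + s *\<^sub>R b)) has_real_derivative G b t) (at t)) \<and>
          (G b has_real_derivative H b) (at 0)) \<and> L = (\<Sum>b\<in>Basis. H b))"

lemma has_laplacianI:
  assumes "\<And>b. b \<in> Basis \<Longrightarrow>
      \<forall>\<^sub>F t in nhds 0. ((\<lambda>s. f (x + s *\<^sub>R b)) has_real_derivative G b t) (at t)"
    and "\<And>b. b \<in> Basis \<Longrightarrow> (G b has_real_derivative H b) (at 0)"
    and "L = (\<Sum>b\<in>Basis. H b)"
  shows "has_laplacian f L x"
  using assms unfolding has_laplacian_def by blast

lemma has_laplacian_const: "has_laplacian (\<lambda>_. c) 0 x"
  by (rule has_laplacianI[where G = "\<lambda>_ _. 0" and H = "\<lambda>_. 0"]) auto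

lemma has_laplacian_lincomb:
  assumes "has_laplacian f L x" "has_laplacian g M x"
  shows "has_laplacian (\<lambda>x. f x + c * g x) (L + c * M) x"
proof -
  obtain G H where 1: "\<And>b. b \<in> Basis \<Longrightarrow>
      \<forall>\<^sub>F t in nhds 0. ((\<lambda>s. f (x + s *\<^sub>R b)) has_real_derivative G b t) (at t)"
    "\<And>b. b \<in> Basis \<Longrightarrow> (G b has_real_derivative H b) (at 0)" "L = (\<Sum>b\<in>Basis. H b)"
    using assms(1) unfolding has_laplacian_def by blast
  obtain G' H' where 2: "\<And>b. b \<in> Basis \<Longrightarrow>
      \<forall>\<^sub>F t in nhds 0. ((\<lambda>s. g (x + s *\<^sub>R b)) has_real_derivative G' b t) (at t)"
    "\<And>b. b \<in> Basis \<Longrightarrow> (G' b has_real_derivative H' b) (at 0)" "M = (\<Sum>b\<in>Basis. H' b)"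
    using assms(2) unfolding has_laplacian_def by blast
  show ?thesis
  proof (rule has_laplacianI[where G = "\<lambda>b t. G b t + c * G' b t" and H = "\<lambda>b. H b + c * H' b"])
    fix b :: 'a assume b: "b \<in> Basis"
    show "\<forall>\<^sub>F t in nhds 0. ((\<lambda>s. f (x + s *\<^sub>R b) + c * g (x + s *\<^sub>R b))
            has_real_derivative G b t + c * G' b t) (at t)"
      using 1(1)[OF b] 2(1)[OF b] by eventually_elim (auto intro!: derivative_eq_intros)
    show "((\<lambda>t. G b t + c * G' b t) has_real_derivative H b + c * H' b) (at 0)"
      using 1(2)[OF b] 2(2)[OF b] by (auto intro!: derivative_eq_intros)
  qed (simp add: 1(3) 2(3) sum.distrib sum_distrib_left)
qed

lemma has_laplacian_diff:
  assumes "has_laplacian f L x" "has_laplacian g M x"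
  shows "has_laplacian (\<lambda>x. f x - g x) (L - M) x"
  using has_laplacian_lincomb[OF assms, of "-1"] by simp

lemma has_laplacian_cong:
  assumes "has_laplacian f L x" and eq: "\<forall>\<^sub>F y in nhds x. f y = g y"
  shows "has_laplacian g L x"
proof -
  obtain G H where 1: "\<And>b. b \<in> Basis \<Longrightarrow>
      \<forall>\<^sub>F t in nhds 0. ((\<lambda>s. f (x + s *\<^sub>R b)) has_real_derivative G b t) (at t)"
    "\<And>b. b \<in> Basis \<Longrightarrow> (G b has_real_derivative H b) (at 0)" "L = (\<Sum>b\<in>Basis. H b)"
    using assms(1) unfolding has_laplacian_def by blast
  show ?thesis
  proof (rule has_laplacianI[where G = G and H = H])
    fix b :: 'a assume b: "b \<in> Basis"
    have "((\<lambda>s. x + s *\<^sub>R b) \<longlongrightarrow> x + 0 *\<^sub>R b) (nhds 0)"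
      by (intro tendsto_intros filterlim_ident)
    hence "\<forall>\<^sub>F s in nhds 0. f (x + s *\<^sub>R b) = g (x + s *\<^sub>R b)"
      using eventually_compose_filterlim[OF eq, of "\<lambda>s. x + s *\<^sub>R b" "nhds 0"] by simp
    hence "\<forall>\<^sub>F t in nhds 0. \<forall>\<^sub>F s in nhds t. f (x + s *\<^sub>R b) = g (x + s *\<^sub>R b)"
      by (simp add: eventually_eventually)
    with 1(1)[OF b]
    show "\<forall>\<^sub>F t in nhds 0. ((\<lambda>s. g (x + s *\<^sub>R b)) has_real_derivative G b t) (at t)"
      by eventually_elim (simp add: DERIV_cong_ev[OF refl _ refl])
  qed (use 1 in auto)
qed

text \<open>If the second derivative at the minimum \<open>0\<close> were negative, then \<open>g\<close>, which vanishes at \<open>0\<close>, would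
be negative just to the right, and \<open>f\<close> would drop below its minimum.\<close>

lemma second_derivative_nonneg_at_min:
  fixes f :: "real \<Rightarrow> real"
  assumes d1: "\<forall>\<^sub>F t in nhds 0. (f has_real_derivative g t) (at t)"
    and d2: "(g has_real_derivative l) (at 0)"
    and min: "\<forall>\<^sub>F t in nhds 0. f 0 \<le> f t"
  shows "0 \<le> l"
proof (rule ccontr)
  assume "\<not> 0 \<le> l"
  hence l: "l < 0" by simp
  obtain e1 where e1: "e1 > 0" "\<And>t. \<bar>t\<bar> < e1 \<Longrightarrow> (f has_real_derivative g t) (at t)"
    using d1 unfolding eventually_nhds_metric by (auto simp: dist_real_def)
  obtain e2 where e2: "e2 > 0" "\<And>t. \<bar>t\<bar> < e2 \<Longrightarrow> f 0 \<le> f t"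
    using min unfolding eventually_nhds_metric by (auto simp: dist_real_def)
  have "g 0 = 0"
    by (rule DERIV_local_min[OF e1(2)[of 0] e2(1)]) (use e1 e2 in auto)
  then obtain d where d: "d > 0" "\<And>h. 0 < h \<Longrightarrow> h < d \<Longrightarrow> g h < 0"
    using DERIV_neg_dec_right[OF d2 l] by auto
  define e where "e = Min {e1, e2, d} / 2"
  have e: "e > 0" "e < e1" "e < e2" "e < d" using e1 e2 d by (auto simp: e_def)
  have "f e < f 0"
  proof (rule DERIV_neg_imp_decreasing_open[OF e(1)])
    fix t assume "0 < t" "t < e"
    thus "\<exists>y. (f has_real_derivative y) (at t) \<and> y < 0"
      using e e1(2)[of t] d(2)[of t] by (intro exI[of _ "g t"]) auto
  next
    show "continuous_on {0..e} f"
      by (rule continuous_at_imp_continuous_on) (use e e1(2) DERIV_isCont in force)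
  qed
  thus False using e2(2)[of e] e by simp
qed

lemma laplacian_nonneg_at_min:
  assumes "has_laplacian f L x" and min: "\<forall>\<^sub>F y in nhds x. f x \<le> f y"
  shows "0 \<le> L"
proof -
  obtain G H where 1: "\<And>b. b \<in> Basis \<Longrightarrow>
      \<forall>\<^sub>F t in nhds 0. ((\<lambda>s. f (x + s *\<^sub>R b)) has_real_derivative G b t) (at t)"
    "\<And>b. b \<in> Basis \<Longrightarrow> (G b has_real_derivative H b) (at 0)" "L = (\<Sum>b\<in>Basis. H b)"
    using assms(1) unfolding has_laplacian_def by blast
  have "0 \<le> H b" if b: "b \<in> Basis" for b
  proof (rule second_derivative_nonneg_at_min[OF 1(1)[OF b] 1(2)[OF b]])
    have "((\<lambda>s. x + s *\<^sub>R b) \<longlongrightarrow> x + 0 *\<^sub>R b) (nhds 0)"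
      by (intro tendsto_intros filterlim_ident)
    thus "\<forall>\<^sub>F s in nhds 0. f (x + 0 *\<^sub>R b) \<le> f (x + s *\<^sub>R b)"
      using eventually_compose_filterlim[OF min, of "\<lambda>s. x + s *\<^sub>R b" "nhds 0"] by simp
  qed
  thus ?thesis by (simp add: 1(3) sum_nonneg)
qed

lemma has_laplacian_radial:
  fixes x q :: "'a::euclidean_space"
  assumes d1: "\<forall>\<^sub>F s in nhds ((norm (x - q))\<^sup>2). (\<phi> has_real_derivative \<phi>' s) (at s)"
    and d2: "(\<phi>' has_real_derivative \<phi>'') (at ((norm (x - q))\<^sup>2))"
  shows "has_laplacian (\<lambda>y. \<phi> ((norm (y - q))\<^sup>2))
     (4 * \<phi>'' * (norm (x - q))\<^sup>2 + 2 * real DIM('a) * \<phi>' ((norm (x - q))\<^sup>2)) x"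
proof -
  define s where "s = (norm (x - q))\<^sup>2"
  define S where "S = (\<lambda>b t. (norm (x - q))\<^sup>2 + 2 * t * ((x - q) \<bullet> b) + t\<^sup>2)"
  have S: "(norm (x + t *\<^sub>R b - q))\<^sup>2 = S b t" if "b \<in> Basis" for b t
    using that unfolding S_def power2_norm_eq_inner
    by (simp add: algebra_simps inner_commute inner_diff_left inner_diff_right inner_add_left inner_add_right power2_eq_square)
  have S0: "S b 0 = s" for b by (simp add: S_def s_def)
  have dS: "(S b has_real_derivative 2 * ((x - q) \<bullet> b) + 2 * t) (at t)" for b t
    unfolding S_def by (auto intro!: derivative_eq_intros)
  show ?thesis
  proof (rule has_laplacianI[where
      G = "\<lambda>b t. \<phi>' (S b t) * (2 * ((x - q) \<bullet> b) + 2 * t)" and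
      H = "\<lambda>b. \<phi>'' * (2 * ((x - q) \<bullet> b))\<^sup>2 + 2 * \<phi>' s"])
    fix b :: 'a assume b: "b \<in> Basis"
    have "isCont (S b) 0" using dS DERIV_isCont by blast
    hence "(S b \<longlongrightarrow> s) (nhds 0)"
      by (simp add: isCont_def S0 tendsto_nhds_iff)
    from eventually_compose_filterlim[OF d1[folded s_def] this]
    show "\<forall>\<^sub>F t in nhds 0. ((\<lambda>r. \<phi> ((norm (x + r *\<^sub>R b - q))\<^sup>2)) has_real_derivative
        \<phi>' (S b t) * (2 * ((x - q) \<bullet> b) + 2 * t)) (at t)"
      unfolding S[OF b] by eventually_elim (rule DERIV_chain2[OF _ dS])
    have "(\<phi>' has_real_derivative \<phi>'') (at (S b 0))" using d2 S0 by (simp add: s_def)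
    from DERIV_chain2[OF this dS]
    have "((\<lambda>t. \<phi>' (S b t)) has_real_derivative \<phi>'' * (2 * ((x - q) \<bullet> b))) (at 0)" by simp
    thus "((\<lambda>t. \<phi>' (S b t) * (2 * ((x - q) \<bullet> b) + 2 * t)) has_real_derivative
        \<phi>'' * (2 * ((x - q) \<bullet> b))\<^sup>2 + 2 * \<phi>' s) (at 0)"
      by (auto intro!: derivative_eq_intros simp: S0 power2_eq_square)
  next
    have "(\<Sum>b\<in>Basis. ((x - q) \<bullet> b)\<^sup>2) = s"
      unfolding s_def power2_norm_eq_inner euclidean_inner[of "x - q" "x - q"]
      by (simp add: power2_eq_square)
    thus "4 * \<phi>'' * (norm (x - q))\<^sup>2 + 2 * real DIM('a) * \<phi>' ((norm (x - q))\<^sup>2) =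
        (\<Sum>b\<in>Basis. \<phi>'' * (2 * ((x - q) \<bullet> b))\<^sup>2 + 2 * \<phi>' s)"
      by (simp add: s_def sum.distrib power_mult_distrib flip: sum_distrib_left)
  qed
qed

text \<open>The common core of the barrier arguments: a negative minimum would be an interior point, where a
negative Laplacian is impossible.\<close>

lemma nonneg_if_laplacian_neg:
  fixes f :: "'a::euclidean_space \<Rightarrow> real"
  assumes A: "compact A" "continuous_on A f"
    and neg: "\<And>x. x \<in> A \<Longrightarrow> f x < 0 \<Longrightarrow> x \<in> interior A \<and> (\<exists>L<0. has_laplacian f L x)"
    and x: "x \<in> A"
  shows "f x \<ge> 0"
proof (rule ccontr)
  assume "\<not> f x \<ge> 0"
  obtain y where y: "y \<in> A" "\<And>w. w \<in> A \<Longrightarrow> f y \<le> f w"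
    using continuous_attains_inf[OF A(1) _ A(2)] x by blast
  have "f y < 0" using y(2)[OF x] \<open>\<not> f x \<ge> 0\<close> by simp
  from neg[OF y(1) this] obtain L where L: "y \<in> interior A" "L < 0" "has_laplacian f L y" by blast
  have "\<forall>\<^sub>F w in nhds y. w \<in> A"
    using L(1) by (rule eventually_nhds_in_nhd)
  hence "\<forall>\<^sub>F w in nhds y. f y \<le> f w" by eventually_elim (rule y(2))
  from laplacian_nonneg_at_min[OF L(3) this] L(2) show False by simp
qed

text \<open>A positive strict supersolution \<open>\<phi>\<close> of \<open>\<Delta> + C\<close> on a region forces the minimum principle for
\<open>\<Delta> + C\<close> there, although the zeroth order term has the bad sign: slide a negative multiple
\<open>m \<phi>\<close> up until it touches \<open>z\<close> from below, and compare Laplacians at the touching point.\<close>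

lemma weak_minimum_principle:
  fixes z \<phi> :: "'a::euclidean_space \<Rightarrow> real"
  assumes A: "compact A" "continuous_on A z" "continuous_on A \<phi>"
    and pos: "\<And>x. x \<in> A \<Longrightarrow> \<phi> x > 0"
    and sup: "\<And>x. x \<in> interior A \<Longrightarrow> \<exists>M. has_laplacian \<phi> M x \<and> M < - C * \<phi> x"
    and z: "\<And>x. x \<in> A \<Longrightarrow> z x < 0 \<Longrightarrow>
      x \<in> interior A \<and> (\<exists>L. has_laplacian z L x \<and> L \<le> - C * z x)"
    and x: "x \<in> A"
  shows "z x \<ge> 0"
proof (rule ccontr)
  assume neg: "\<not> z x \<ge> 0"
  have "continuous_on A (\<lambda>x. z x / \<phi> x)"
    using A pos by (intro continuous_intros) force+
  then obtain y where y: "y \<in> A" "\<And>w. w \<in> A \<Longrightarrow> z y / \<phi> y \<le> z w / \<phi> w"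
    using continuous_attains_inf[OF A(1), of "\<lambda>x. z x / \<phi> x"] x by blast
  define m where "m = z y / \<phi> y"
  have "m < 0" proof -
    have "z x / \<phi> x < 0" using neg pos[OF x] by (simp add: divide_neg_pos)
    thus ?thesis using y(2)[OF x] by (simp add: m_def)
  qed
  have zy: "z y = m * \<phi> y" using pos[OF y(1)] by (simp add: m_def)
  have "z y < 0" using zy \<open>m < 0\<close> pos[OF y(1)] by (simp add: mult_neg_pos)
  from z[OF y(1) this] obtain L where L: "y \<in> interior A" "has_laplacian z L y" "L \<le> - C * z y"
    by blast
  from sup[OF L(1)] obtain M where M: "has_laplacian \<phi> M y" "M < - C * \<phi> y" by blast
  have "\<forall>\<^sub>F w in nhds y. w \<in> A"
    using L(1) by (rule eventually_nhds_in_nhd)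
  hence "\<forall>\<^sub>F w in nhds y. z y + (- m) * \<phi> y \<le> z w + (- m) * \<phi> w"
  proof eventually_elim
    case (elim w)
    show ?case using y(2)[OF elim, folded m_def] pos[OF elim] zy by (simp add: pos_le_divide_eq)
  qed
  from laplacian_nonneg_at_min[OF has_laplacian_lincomb[OF L(2) M(1)] this]
  have "0 \<le> L - m * M" by simp
  moreover have "- m * M < - m * (- C * \<phi> y)" using M(2) \<open>m < 0\<close> by (intro mult_strict_left_mono) auto
  ultimately show False using L(3) zy by (simp add: algebra_simps)
qed

text \<open>Positivity at the centre spreads to the whole ball. The barrier is a small multiple of Hopf's function
\<open>exp (- \<alpha> |x - q|\<^sup>2) - exp (- \<alpha> R\<^sup>2)\<close>: it vanishes on the outer sphere, lies below \<open>z\<close> on a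
small ball around \<open>q\<close>, and for large \<open>\<alpha>\<close> is a strict subsolution in between. The differential
inequality is required only where \<open>z\<close> is at most \<open>1\<close>: wherever \<open>z\<close> is below the barrier it is
small, and in this form the inequality follows from a nonlinear equation without an upper bound
for \<open>z\<close>.\<close>

lemma positive_on_ball:
  fixes z :: "'a::euclidean_space \<Rightarrow> real"
  assumes z: "continuous_on (cball q R) z" "\<And>x. x \<in> cball q R \<Longrightarrow> z x \<ge> 0" "z q > 0"
    and C: "C > 0"
    and sup: "\<And>x. x \<in> ball q R \<Longrightarrow> \<exists>L. has_laplacian z L x \<and> (z x \<le> 1 \<longrightarrow> L \<le> C * z x)"
    and x: "x \<in> ball q R"
  shows "z x > 0"
proof -
  have R: "R > 0" using x by (metis ball_eq_empty empty_iff not_le)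
  obtain r m where r: "0 < r" "r < R" and m: "m > 0" "\<And>y. dist q y \<le> r \<Longrightarrow> z y \<ge> m"
  proof -
    have "\<exists>d>0. \<forall>y\<in>cball q R. dist y q < d \<longrightarrow> dist (z y) (z q) < z q / 2"
      using z(1)[unfolded continuous_on_iff, rule_format, of q "z q / 2"] z(3) R by simp
    then obtain d where d: "d > 0" "\<And>y. y \<in> cball q R \<Longrightarrow> dist y q < d \<Longrightarrow> dist (z y) (z q) < z q / 2"
      by blast
    define r where "r = min d R / 2"
    have "0 < r" "r < R" "r < d" using d(1) R by (auto simp: r_def)
    moreover have "z y \<ge> z q / 2" if "dist q y \<le> r" for y
    proof -
      have "y \<in> cball q R" "dist y q < d" using that \<open>r < R\<close> \<open>r < d\<close> by (auto simp: dist_commute)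
      from d(2)[OF this] show ?thesis by (auto simp: dist_real_def abs_if split: if_splits)
    qed
    ultimately show ?thesis using z(3) that[of r "z q / 2"] by auto
  qed
  define n where "n = real DIM('a)"
  \<comment> \<open>large enough for \<open>4 \<alpha> r\<^sup>2 - 2 n > C\<close>, where \<open>r\<close> is the inner radius\<close>
  define \<alpha> where "\<alpha> = (2 * n + C) / (4 * r\<^sup>2) + 1"
  define \<epsilon> where "\<epsilon> = min m 1"
  define \<phi> where "\<phi> = (\<lambda>s. \<epsilon> * (exp (- \<alpha> * s) - exp (- \<alpha> * R\<^sup>2)))"
  define h where "h = (\<lambda>y. \<phi> ((norm (y - q))\<^sup>2))"
  have n: "n \<ge> 0" by (simp add: n_def)
  have \<epsilon>: "0 < \<epsilon>" "\<epsilon> \<le> m" "\<epsilon> \<le> 1" using m by (auto simp: \<epsilon>_def)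
  have a1: "\<alpha> \<ge> 1" using n C by (simp add: \<alpha>_def)
  have "4 * r\<^sup>2 * \<alpha> = 2 * n + C + 4 * r\<^sup>2" using r by (simp add: \<alpha>_def field_simps)
  hence a2: "4 * \<alpha> * r\<^sup>2 - 2 * n > C" using r by (simp add: mult.commute mult.left_commute)
  define A where "A = cball q R - ball q r"
  have A: "compact A" by (simp add: A_def compact_diff)
  have hA: "h y \<le> \<epsilon>" for y
  proof -
    have "exp (- \<alpha> * (norm (y - q))\<^sup>2) \<le> 1" using a1 by simp
    hence "exp (- \<alpha> * (norm (y - q))\<^sup>2) - exp (- \<alpha> * R\<^sup>2) \<le> 1" by (smt (verit) exp_gt_zero)
    from mult_left_mono[OF this, of \<epsilon>] \<epsilon>(1) show ?thesis by (simp add: h_def \<phi>_def)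
  qed
  have ge: "z y - h y \<ge> 0" if y: "y \<in> A" for y
  proof (rule nonneg_if_laplacian_neg[OF A _ _ y])
    show "continuous_on A (\<lambda>y. z y - h y)" unfolding h_def \<phi>_def
      by (intro continuous_intros continuous_on_subset[OF z(1)]) (auto simp: A_def)
    fix y assume y: "y \<in> A" and neg: "z y - h y < 0"
    have d: "dist q y \<noteq> r"
    proof
      assume "dist q y = r"
      hence "z y \<ge> m" using m(2) by simp
      thus False using hA[of y] neg \<epsilon> by simp
    qed
    have "dist q y \<noteq> R"
    proof
      assume "dist q y = R"
      hence "h y = 0" by (simp add: h_def \<phi>_def dist_norm norm_minus_commute)
      thus False using neg z(2)[of y] y by (simp add: A_def)
    qed
    with d y have d: "r < dist q y" "dist q y < R" by (auto simp: A_def)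
    have "y \<in> ball q R - cball q r" using d by simp
    moreover have "open (ball q R - cball q r)" by (simp add: open_Diff)
    moreover have "ball q R - cball q r \<subseteq> A" by (auto simp: A_def)
    ultimately have int: "y \<in> interior A" using interiorI by blast
    have "z y \<le> 1" using neg hA[of y] \<epsilon> by simp
    then obtain L where L: "has_laplacian z L y" "L \<le> C * z y" using sup[of y] d by auto
    define s where "s = (norm (y - q))\<^sup>2"
    have s: "s > r\<^sup>2" using d r by (simp add: s_def dist_norm norm_minus_commute power_strict_mono)
    have hl: "has_laplacian h (4 * (\<epsilon> * \<alpha>\<^sup>2 * exp (- \<alpha> * s)) * s + 2 * n * (- \<epsilon> * \<alpha> * exp (- \<alpha> * s))) y"
      unfolding h_def s_def n_def
      by (rule has_laplacian_radial[where \<phi>' = "\<lambda>s. - \<epsilon> * \<alpha> * exp (- \<alpha> * s)"])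
         (auto intro!: derivative_eq_intros always_eventually simp: \<phi>_def power2_eq_square)
    have "\<alpha> * r\<^sup>2 \<le> \<alpha> * s" using s a1 by simp
    hence "C < 4 * \<alpha> * s - 2 * n" using a2 by simp
    also have "\<dots> \<le> \<alpha> * (4 * \<alpha> * s - 2 * n)"
      using a1 calculation C by (simp add: mult_le_cancel_right1)
    finally have "C * (\<epsilon> * exp (- \<alpha> * s)) < \<alpha> * (4 * \<alpha> * s - 2 * n) * (\<epsilon> * exp (- \<alpha> * s))"
      using \<epsilon>(1) by (intro mult_strict_right_mono) auto
    also have "\<dots> = 4 * (\<epsilon> * \<alpha>\<^sup>2 * exp (- \<alpha> * s)) * s + 2 * n * (- \<epsilon> * \<alpha> * exp (- \<alpha> * s))"
      by (simp add: algebra_simps power2_eq_square)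
    finally have M: "C * (\<epsilon> * exp (- \<alpha> * s)) < \<dots>" .
    have "h y \<le> \<epsilon> * exp (- \<alpha> * s)" using \<epsilon>(1) by (simp add: h_def \<phi>_def s_def)
    hence "C * h y \<le> C * (\<epsilon> * exp (- \<alpha> * s))" using C by simp
    moreover have "C * z y < C * h y" using neg C by simp
    ultimately have "L - (4 * (\<epsilon> * \<alpha>\<^sup>2 * exp (- \<alpha> * s)) * s + 2 * n * (- \<epsilon> * \<alpha> * exp (- \<alpha> * s))) < 0"
      using M L(2) by linarith
    with has_laplacian_diff[OF L(1) hl] int
    show "y \<in> interior A \<and> (\<exists>L<0. has_laplacian (\<lambda>y. z y - h y) L y)" by blast
  qed
  show ?thesis
  proof (cases "dist q x \<le> r")
    case True thus ?thesis using m by force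
  next
    case False
    have "(norm (x - q))\<^sup>2 < R\<^sup>2"
      using x by (simp add: dist_norm norm_minus_commute power_strict_mono)
    hence "h x > 0" using \<epsilon>(1) a1 by (simp add: h_def \<phi>_def)
    thus ?thesis using ge[of x] False x by (simp add: A_def)
  qed
qed

text \<open>The set where \<open>z > 0\<close> is open; by the previous lemma it is also closed in \<open>W\<close>, because a limit point lies in a
ball inside \<open>W\<close> around some point of positivity.\<close>

lemma strong_minimum_principle:
  fixes z :: "'a::euclidean_space \<Rightarrow> real"
  assumes W: "open W" "connected W"
    and z: "continuous_on W z" "\<And>x. x \<in> W \<Longrightarrow> z x \<ge> 0"
    and C: "C > 0"
    and sup: "\<And>x. x \<in> W \<Longrightarrow> \<exists>L. has_laplacian z L x \<and> (z x \<le> 1 \<longrightarrow> L \<le> C * z x)"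
  shows "(\<forall>x\<in>W. z x > 0) \<or> (\<forall>x\<in>W. z x = 0)"
proof -
  define P where "P = {x\<in>W. z x > 0}"
  have "openin (top_of_set W) P"
  proof -
    have "P = W \<inter> z -` {0<..}" by (auto simp: P_def)
    thus ?thesis by (simp add: continuous_openin_preimage_gen z(1))
  qed
  moreover have "closedin (top_of_set W) P"
  proof -
    have "closure P \<inter> W \<subseteq> P"
    proof
      fix x assume x: "x \<in> closure P \<inter> W"
      then obtain e where e: "e > 0" "cball x e \<subseteq> W" using W(1) open_contains_cball by blast
      obtain q where q: "q \<in> P" "dist q x < e / 2"
        using x e(1) by (meson IntD1 closure_approachable half_gt_zero)
      have sub: "cball q (e / 2) \<subseteq> W"
      proof
        fix y assume "y \<in> cball q (e / 2)"
        hence "dist x y \<le> e" using q(2) dist_triangle[of x y q] by (simp add: dist_commute)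
        thus "y \<in> W" using e(2) by auto
      qed
      have "z x > 0"
      proof (rule positive_on_ball[of q "e/2" z C])
        show "continuous_on (cball q (e / 2)) z" using z(1) sub continuous_on_subset by blast
      qed (use sub z(2) q C sup in \<open>auto simp: P_def subset_iff\<close>)
      thus "x \<in> P" using x by (simp add: P_def)
    qed
    moreover have "P \<subseteq> W" by (auto simp: P_def)
    ultimately have "P = W \<inter> closure P" using closure_subset by blast
    thus ?thesis by (metis closed_closure closedin_closed_Int)
  qed
  ultimately have "P = {} \<or> P = W" using W(2) by (simp add: connected_clopen)
  thus ?thesis using z(2) by (fastforce simp: P_def)
qed

lemma inverse_power_eq_powr:
  assumes "r > 0" shows "(1 / r) ^ k = (r\<^sup>2) powr (- (real k / 2))"
proof -
  have "r\<^sup>2 = r powr 2" using assms by simp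
  hence "(r\<^sup>2) powr (- (real k / 2)) = r powr (- real k)" by (simp add: powr_powr)
  thus ?thesis using assms by (simp add: powr_minus powr_realpow power_divide inverse_eq_divide)
qed

text \<open>A positive supersolution near infinity decays no faster than the fundamental solution, even in the
presence of a potential of size \<open>|x|\<close> to the power \<open>-4\<close>. The barrier is
\<open>\<epsilon> (|x| powr (2 - n) + C |x| powr (- n))\<close>: its first term is harmonic, and the Laplacian
\<open>2 n C |x| powr (- n - 2)\<close> of the second outweighs the potential once \<open>|x|\<^sup>2 \<ge> C\<close>. The
barrier tends to \<open>0\<close> at infinity, where \<open>z\<close> is positive, so a negative value of the difference would
be attained as a minimum. In terms of
\<open>s = |x|\<^sup>2\<close> and \<open>m = (n - 2) / 2\<close> it reads \<open>\<epsilon> (s powr (- m) + C s powr (- m - 1))\<close>.\<close>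

lemma positive_supersolution_at_infinity:
  fixes z :: "'a::euclidean_space \<Rightarrow> real"
  assumes dim: "DIM('a) \<ge> 3" and R0: "R0 > 0"
    and z: "continuous_on {x. norm x \<ge> R0} z" "\<And>x. norm x \<ge> R0 \<Longrightarrow> z x > 0"
    and C: "C > 0"
    and sup: "\<And>x. norm x > R0 \<Longrightarrow> \<exists>L. has_laplacian z L x \<and>
       (z x \<le> (1 / norm x) ^ (DIM('a) - 2) \<longrightarrow> L \<le> C / norm x ^ 4 * z x)"
  shows "\<exists>c>0. \<forall>x. norm x \<ge> R0 \<longrightarrow> z x \<ge> c * (1 / norm x) ^ (DIM('a) - 2)"
proof -
  define n where "n = real DIM('a)"
  define m where "m = (n - 2) / 2"
  define R where "R = max R0 (max 1 (sqrt C))"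
  have n3: "n \<ge> 3" using dim by (simp add: n_def)
  have R: "R \<ge> R0" "R \<ge> 1" "R\<^sup>2 \<ge> C"
  proof -
    have "sqrt C \<le> R" by (simp add: R_def)
    from power_mono[OF this, of 2] show "R\<^sup>2 \<ge> C" using C by simp
  qed (auto simp: R_def)
  have real_dim: "real (DIM('a) - 2) = n - 2" using dim by (simp add: n_def of_nat_diff)
  define w where "w = (\<lambda>x::'a. (1 / norm x) ^ (DIM('a) - 2))"
  have w: "w x = ((norm x)\<^sup>2) powr (- m)" if "norm x > 0" for x
    unfolding w_def using inverse_power_eq_powr[OF that, of "DIM('a) - 2"] real_dim by (simp add: m_def)
  have cmp: "compact {x::'a. a \<le> norm x \<and> norm x \<le> b}" for a b
  proof -
    have "{x::'a. a \<le> norm x \<and> norm x \<le> b} = cball 0 b - ball 0 a" by auto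
    thus ?thesis by (simp add: compact_diff)
  qed
  have lowR: "\<exists>c>0. \<forall>x. R0 \<le> norm x \<and> norm x \<le> R \<longrightarrow> z x \<ge> c"
  proof (cases "{x::'a. R0 \<le> norm x \<and> norm x \<le> R} = {}")
    case True thus ?thesis by (intro exI[of _ 1]) auto
  next
    case False
    have "continuous_on {x. R0 \<le> norm x \<and> norm x \<le> R} z" by (rule continuous_on_subset[OF z(1)]) auto
    from continuous_attains_inf[OF cmp False this] obtain y where
      "R0 \<le> norm y" "\<And>x. R0 \<le> norm x \<and> norm x \<le> R \<Longrightarrow> z y \<le> z x" by auto
    thus ?thesis using z(2) by blast
  qed
  then obtain c where c: "c > 0" "\<And>x. R0 \<le> norm x \<Longrightarrow> norm x \<le> R \<Longrightarrow> z x \<ge> c" by blast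
  define \<epsilon> where "\<epsilon> = min c 1 / 2"
  have \<epsilon>: "\<epsilon> > 0" "2 * \<epsilon> \<le> c" "2 * \<epsilon> \<le> 1" using c(1) by (auto simp: \<epsilon>_def)
  define \<phi> where "\<phi> = (\<lambda>s. \<epsilon> * (s powr (- m) + C * s powr (- m - 1)))"
  define h where "h = (\<lambda>x::'a. \<phi> ((norm (x - 0))\<^sup>2))"
  have w1: "w x \<le> 1" if "norm x \<ge> 1" for x :: 'a
    unfolding w_def by (rule power_le_one) (use that in \<open>auto simp: divide_le_eq_1\<close>)
  have h_le: "h x \<le> 2 * \<epsilon> * w x" if x: "norm x \<ge> R" for x
  proof -
    have pos: "(norm x)\<^sup>2 \<ge> C" "norm x > 0"
      using R x power_mono[OF x, of 2] by linarith+
    have "C * ((norm x)\<^sup>2) powr (- m - 1) = (C / (norm x)\<^sup>2) * ((norm x)\<^sup>2) powr (- m)"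
      using pos by (simp add: powr_diff)
    also have "\<dots> \<le> 1 * ((norm x)\<^sup>2) powr (- m)"
      using pos C by (intro mult_right_mono) auto
    finally have "\<epsilon> * (((norm x)\<^sup>2) powr (- m) + C * ((norm x)\<^sup>2) powr (- m - 1))
       \<le> \<epsilon> * (2 * ((norm x)\<^sup>2) powr (- m))" using \<epsilon>(1) by (intro mult_left_mono) auto
    thus ?thesis using w[OF pos(2)] by (simp add: h_def \<phi>_def)
  qed
  have h_ge: "h x \<ge> \<epsilon> * w x" if x: "norm x \<ge> R" for x
  proof -
    have pos: "norm x > 0" using R x by linarith
    show ?thesis using w[OF pos] \<epsilon>(1) C by (simp add: h_def \<phi>_def)
  qed
  have lap: "\<exists>L<0. has_laplacian (\<lambda>x. z x - h x) L x"
    if x: "norm x > R" and neg: "z x < h x" for x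
  proof -
    define s where "s = (norm x)\<^sup>2"
    have nx: "norm x > 0" "norm x > R0" using R x by linarith+
    have s: "s > 0" using nx by (simp add: s_def)
    have "2 * \<epsilon> * w x \<le> 1 * w x" using \<epsilon> by (intro mult_right_mono) (auto simp: w_def)
    hence "z x \<le> w x" using neg h_le[of x] x by simp
    then obtain L where L: "has_laplacian z L x" "L \<le> C / norm x ^ 4 * z x"
      using sup[OF nx(2)] by (auto simp: w_def)
    have s2: "norm x ^ 4 = s\<^sup>2" by (simp add: s_def flip: power_mult)
    have ev: "\<forall>\<^sub>F t in nhds s. t > 0"
      using s(1) eventually_nhds_in_open[of "{0<..}" s] by simp
    have hl: "has_laplacian h (4 * (\<epsilon> * (m * (m + 1) * s powr (- m - 2) + C * ((m + 1) * (m + 2)) * s powr (- m - 3))) * (norm (x-0))\<^sup>2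
        + 2 * n * (\<epsilon> * (- m * ((norm (x-0))\<^sup>2) powr (- m - 1) - C * (m + 1) * ((norm (x-0))\<^sup>2) powr (- m - 2)))) x"
      unfolding h_def n_def
    proof (rule has_laplacian_radial)
      show "\<forall>\<^sub>F s in nhds ((norm (x - 0))\<^sup>2). (\<phi> has_real_derivative
         \<epsilon> * (- m * s powr (- m - 1) - C * (m + 1) * s powr (- m - 2))) (at s)"
        using ev unfolding s_def diff_zero
      proof eventually_elim
        case (elim t)
        have "- m - 2 = - m - 1 - 1" by simp
        thus ?case using elim unfolding \<phi>_def
          by (auto intro!: derivative_eq_intros simp: algebra_simps)
      qed
      have e: "- m - 3 = - m - 2 - 1" "- m - 2 = - m - 1 - 1" by simp_all
      show "((\<lambda>s. \<epsilon> * (- m * s powr (- m - 1) - C * (m + 1) * s powr (- m - 2)))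
         has_real_derivative \<epsilon> * (m * (m + 1) * s powr (- m - 2) + C * ((m + 1) * (m + 2)) * s powr (- m - 3)))
         (at ((norm (x - 0))\<^sup>2))"
        using s(1) unfolding s_def diff_zero
        by (auto intro!: derivative_eq_intros simp: algebra_simps simp flip: e)
    qed
    have p1: "s powr (- m - 1) = s powr (- m) / s" using s(1) by (simp add: powr_diff)
    have p2: "s powr (- m - 2) = s powr (- m) / s\<^sup>2" using s(1) by (simp add: powr_diff)
    have p3: "s powr (- m - 3) = s powr (- m) / s^3" using s(1) by (simp add: powr_diff)
    have n: "n = 2 * m + 2" by (simp add: m_def field_simps)
    have Mval: "(4 * (\<epsilon> * (m * (m + 1) * s powr (- m - 2) + C * ((m + 1) * (m + 2)) * s powr (- m - 3))) * s
        + 2 * n * (\<epsilon> * (- m * s powr (- m - 1) - C * (m + 1) * s powr (- m - 2))))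
      = 2 * n * C * (\<epsilon> * (s powr (- m) / s\<^sup>2))"
      unfolding p1 p2 p3 n using s(1) by (simp add: field_simps power2_eq_square power3_eq_cube)
    have hl': "has_laplacian h (2 * n * C * (\<epsilon> * (s powr (- m) / s\<^sup>2))) x"
      using hl by (simp only: Mval diff_zero flip: s_def)
    have "C / norm x ^ 4 * z x < C / s\<^sup>2 * h x"
      using neg C s(1) by (simp add: s2 divide_strict_right_mono)
    also have "\<dots> \<le> C / s\<^sup>2 * (2 * \<epsilon> * s powr (- m))"
      using h_le[of x] x w[OF nx(1)] C by (intro mult_left_mono) (auto simp: s_def)
    also have "\<dots> = 2 * C * (\<epsilon> * (s powr (- m) / s\<^sup>2))" by simp
    also have "\<dots> \<le> 2 * n * C * (\<epsilon> * (s powr (- m) / s\<^sup>2))"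
      using n3 C \<epsilon>(1) by (intro mult_right_mono) auto
    finally have "L - 2 * n * C * (\<epsilon> * (s powr (- m) / s\<^sup>2)) < 0" using L(2) by linarith
    thus ?thesis using has_laplacian_diff[OF L(1) hl'] by blast
  qed
  have hR: "z x \<ge> h x" if "norm x = R" for x
  proof -
    have "w x \<le> 1" using w1[of x] that R by simp
    hence "2 * \<epsilon> * w x \<le> 2 * \<epsilon>" using \<epsilon>(1) by (simp add: mult_left_le)
    thus ?thesis using h_le[of x] c(2)[of x] that R \<epsilon> by linarith
  qed
  have zh: "z x \<ge> h x" if x: "norm x \<ge> R" for x
  proof (rule ccontr)
    assume neg: "\<not> z x \<ge> h x"
    define \<eta> where "\<eta> = (h x - z x) / 2"
    have \<eta>: "\<eta> > 0" using neg by (simp add: \<eta>_def)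
    define R' where "R' = max (norm x) (1 / \<eta>) + 1"
    have R': "norm x < R'" "1 / \<eta> < R'" "R < R'" using x by (auto simp: R'_def)
    have hfar: "h y \<le> \<eta>" if y: "norm y \<ge> R'" for y
    proof -
      have ny: "norm y \<ge> R" "norm y \<ge> 1" "norm y > 0" "norm y > 1 / \<eta>" using y R' R by linarith+
      have "w y \<le> (1 / norm y) ^ 1" unfolding w_def
        by (rule power_decreasing) (use dim ny in auto)
      also have "\<dots> \<le> \<eta>" using ny(3,4) \<eta> by (simp add: field_simps)
      finally have "w y \<le> \<eta>" .
      moreover have "2 * \<epsilon> * w y \<le> 1 * w y" using \<epsilon> by (intro mult_right_mono) (auto simp: w_def)
      ultimately show ?thesis using h_le[of y] ny by simp
    qed
    define A where "A = {y::'a. R \<le> norm y \<and> norm y \<le> R'}"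
    have contw: "continuous_on A h"
    proof -
      have "(norm y)\<^sup>2 \<noteq> 0" if "y \<in> A" for y using that R by (auto simp: A_def)
      thus ?thesis unfolding h_def \<phi>_def diff_zero by (intro continuous_intros) auto
    qed
    \<comment> \<open>Adding \<open>\<eta>\<close> makes up for the unknown sign of \<open>z - h\<close> on the outer
      sphere, where \<open>h\<close> is already below \<open>\<eta>\<close>, and still leaves a negative value at \<open>x\<close>.\<close>
    have "0 \<le> z x - h x + \<eta>"
    proof (rule nonneg_if_laplacian_neg[of A "\<lambda>x. z x - h x + \<eta>"])
      show "compact A" unfolding A_def by (rule cmp)
      show "continuous_on A (\<lambda>x. z x - h x + \<eta>)"
        by (intro continuous_intros contw continuous_on_subset[OF z(1)]) (use R in \<open>auto simp: A_def\<close>)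
      show "x \<in> A" using x R' by (simp add: A_def)
      fix y assume y: "y \<in> A" "z y - h y + \<eta> < 0"
      have "norm y \<noteq> R" using hR[of y] y(2) \<eta> by force
      moreover have "norm y \<noteq> R'" using hfar[of y] y(2) z(2)[of y] R R' by force
      ultimately have ny: "R < norm y" "norm y < R'" using y(1) by (auto simp: A_def)
      have "y \<in> ball 0 R' - cball 0 R" using ny by simp
      moreover have "open (ball 0 R' - cball 0 R :: 'a set)" by (simp add: open_Diff)
      moreover have "ball 0 R' - cball 0 R \<subseteq> A" by (auto simp: A_def)
      ultimately have int: "y \<in> interior A" using interiorI by blast
      obtain L where L: "L < 0" "has_laplacian (\<lambda>x. z x - h x) L y" using lap[OF ny(1)] y(2) \<eta> by auto
      have "has_laplacian (\<lambda>x. z x - h x + \<eta>) L y"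
        using has_laplacian_lincomb[OF L(2) has_laplacian_const[of 1], of \<eta>] by simp
      thus "y \<in> interior A \<and> (\<exists>L<0. has_laplacian (\<lambda>x. z x - h x + \<eta>) L y)"
        using int L(1) by blast
    qed
    thus False using neg by (simp add: \<eta>_def field_simps)
  qed
  define c' where "c' = min \<epsilon> (c * R0 ^ (DIM('a) - 2))"
  have "c' > 0" using \<epsilon> c R0 by (simp add: c'_def)
  moreover have "z x \<ge> c' * w x" if x: "norm x \<ge> R0" for x
  proof (cases "norm x \<ge> R")
    case True
    have "c' * w x \<le> \<epsilon> * w x" by (intro mult_right_mono) (auto simp: c'_def w_def)
    thus ?thesis using h_ge[OF True] zh[OF True] by linarith
  next
    case False
    have "w x \<le> (1 / R0) ^ (DIM('a) - 2)" unfolding w_def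
      using x R0 by (intro power_mono frac_le) auto
    hence "c' * w x \<le> (c * R0 ^ (DIM('a) - 2)) * (1 / R0) ^ (DIM('a) - 2)"
      using c R0 by (intro mult_mono) (auto simp: c'_def w_def)
    also have "\<dots> = c" using R0 by (simp add: power_divide)
    also have "\<dots> \<le> z x" using c(2) x False by simp
    finally show ?thesis .
  qed
  ultimately show ?thesis unfolding w_def by blast
qed

section \<open>Moving spheres in Euclidean space\<close>

definition inversion :: "real \<Rightarrow> 'a::euclidean_space \<Rightarrow> 'a" where
  "inversion r x = (r / norm x)\<^sup>2 *\<^sub>R x"

text \<open>The parameter \<open>r = 0\<close> is allowed: for dimension at least 3 the transform is then \<open>0\<close>, and the moving
sphere argument can start from it.\<close>

definition kelvin :: "('a::euclidean_space \<Rightarrow> real) \<Rightarrow> real \<Rightarrow> 'a \<Rightarrow> real" where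
  "kelvin u r x = (r / norm x) ^ (DIM('a) - 2) * u (inversion r x)"

lemma norm_inversion: "x \<noteq> 0 \<Longrightarrow> norm (inversion r x) = r\<^sup>2 / norm x"
  by (simp add: inversion_def power2_eq_square)

lemma kelvin_on_sphere:
  assumes "norm x = r" "r > 0"
  shows "kelvin u r x = u x"
  using assms by (simp add: kelvin_def inversion_def)

text \<open>Written like this, \<open>|x| ^ (n - 2)\<close> times the transform is a function of \<open>r\<close> and of the point
\<open>x / |x|\<^sup>2\<close> that remains continuous up to \<open>x = \<infinity>\<close>.\<close>

lemma kelvin_rescaled:
  "kelvin u r x = (1 / norm x) ^ (DIM('a) - 2) *
     (r ^ (DIM('a) - 2) * u (r\<^sup>2 *\<^sub>R ((1 / (norm x)\<^sup>2) *\<^sub>R (x::'a::euclidean_space))))"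
  by (simp add: kelvin_def inversion_def power_divide)

lemma powr_diff_le:
  fixes a b p :: real
  assumes "0 \<le> a" "a \<le> b" "b \<le> B" "1 < p"
  shows "b powr p - a powr p \<le> p * B powr (p - 1) * (b - a)"
proof (cases "a = b")
  case False
  hence ab: "a < b" using assms by simp
  have "\<exists>l z. a < z \<and> z < b \<and> ((\<lambda>x. x powr p) has_real_derivative l) (at z) \<and>
          b powr p - a powr p = (b - a) * l"
  proof (rule MVT[OF ab])
    show "continuous_on {a..b} (\<lambda>x. x powr p)"
      using assms by (intro continuous_on_powr' continuous_intros) auto
    show "(\<lambda>x. x powr p) differentiable at x" if "a < x" "x < b" for x
      using that assms(1) has_real_derivative_powr[of x p]
      by (auto simp: real_differentiable_def)
  qed
  then obtain l z where z: "a < z" "z < b" "((\<lambda>x. x powr p) has_real_derivative l) (at z)"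
    "b powr p - a powr p = (b - a) * l" by blast
  have "l = p * z powr (p - 1)"
    using DERIV_unique[OF z(3) has_real_derivative_powr] z(1) assms(1) by simp
  moreover have "z powr (p - 1) \<le> B powr (p - 1)" using z assms by (intro powr_mono2) auto
  ultimately have "l \<le> p * B powr (p - 1)" using assms by simp
  from mult_left_mono[OF this, of "b - a"] ab z(4) show ?thesis by (simp add: mult_ac)
qed simp

text \<open>The equation \<open>- \<Delta> u = k u powr p\<close> with the conformally invariant exponent, together with the
equations that this implies for the Kelvin transforms of \<open>u\<close>. The latter are listed among the
assumptions because in the application \<open>u\<close> and its transforms are all stereographic pull-backs of
one function on the sphere, and a single computation yields all these equations. The last assumption says that \<open>k\<close> is non-decreasing along rays.\<close>

locale kelvin_family =
  fixes u k :: "'a::euclidean_space \<Rightarrow> real" and k0 :: real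
  assumes dim: "DIM('a) \<ge> 3"
    and cont: "continuous_on UNIV u"
    and pos: "\<And>x. u x > 0"
    and k0: "k0 > 0" "\<And>x. \<bar>k x\<bar> \<le> k0"
    and lap_u: "\<And>x. has_laplacian u
      (- k x * u x powr ((real DIM('a) + 2) / (real DIM('a) - 2))) x"
    and lap_kelvin: "\<And>r x. r > 0 \<Longrightarrow> x \<noteq> 0 \<Longrightarrow> has_laplacian (kelvin u r)
      (- k (inversion r x) * kelvin u r x powr ((real DIM('a) + 2) / (real DIM('a) - 2))) x"
    and k_mono: "\<And>r x. 0 < r \<Longrightarrow> r \<le> norm x \<Longrightarrow> k (inversion r x) \<le> k x"
begin

definition p where "p = (real DIM('a) + 2) / (real DIM('a) - 2)"

lemma p: "p > 1" "p - 1 = 4 / (real DIM('a) - 2)"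
  using dim by (auto simp: p_def field_simps)

lemma kelvin_nonneg: "r \<ge> 0 \<Longrightarrow> kelvin u r x \<ge> 0"
  using pos[of "inversion r x"] by (simp add: kelvin_def)

lemma kelvin_zero: "kelvin u 0 x = 0"
  using dim by (simp add: kelvin_def power_0_left)

lemma kelvin_cont: "continuous_on (- {0}) (kelvin u r)"
  unfolding kelvin_def inversion_def
  by (intro continuous_intros continuous_on_compose2[OF cont]) auto

lemma bound_on_ball:
  obtains M where "M \<ge> 1" "\<And>x. norm x \<le> b \<Longrightarrow> u x \<le> M"
proof -
  have "bounded (u ` cball 0 b)"
    by (intro compact_imp_bounded compact_continuous_image continuous_on_subset[OF cont]) auto
  then obtain M where M: "\<And>x. norm x \<le> b \<Longrightarrow> \<bar>u x\<bar> \<le> M"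
    unfolding bounded_iff by (fastforce simp: image_iff)
  show ?thesis by (rule that[of "max M 1"]) (use M in \<open>auto simp: le_max_iff_disj abs_le_iff\<close>)
qed

lemma kelvin_le:
  assumes M: "\<And>y. norm y \<le> r \<Longrightarrow> u y \<le> M" and x: "x \<noteq> 0" "r \<le> norm x" "r \<ge> 0"
  shows "kelvin u r x \<le> (r / norm x) ^ (DIM('a) - 2) * M"
proof -
  have "r * r \<le> r * norm x" using x by (intro mult_left_mono) auto
  hence "norm (inversion r x) \<le> r"
    using x by (simp add: norm_inversion power2_eq_square divide_le_eq)
  from M[OF this] x show ?thesis unfolding kelvin_def by (intro mult_left_mono) auto
qed

text \<open>Monotonicity of \<open>k\<close> replaces its reflected value by \<open>k x\<close> at the cost of an inequality in the
favourable direction; the mean value theorem for the power then bounds the Laplacian of the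
difference by a multiple of the difference itself. Depending on the sign of the difference, the
constant involves a bound for \<open>u\<close> or only one for its transform.\<close>

lemma difference_laplacian:
  assumes r: "r \<ge> 0" and x: "x \<noteq> 0" "norm x \<ge> r"
  obtains L where "has_laplacian (\<lambda>x. u x - kelvin u r x) L x"
    "\<And>B. u x \<ge> kelvin u r x \<Longrightarrow> u x \<le> B \<Longrightarrow> L \<le> (k0 * p * B powr (p - 1)) * (u x - kelvin u r x)"
    "\<And>B. u x < kelvin u r x \<Longrightarrow> kelvin u r x \<le> B \<Longrightarrow> L \<le> - (k0 * p * B powr (p - 1)) * (u x - kelvin u r x)"
proof -
  define w where "w = kelvin u r x"
  have w: "w \<ge> 0" unfolding w_def by (rule kelvin_nonneg[OF r])
  have "\<exists>j. j \<le> k x \<and> has_laplacian (kelvin u r) (- j * w powr p) x"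
  proof (cases "r = 0")
    case True
    have "kelvin u r = (\<lambda>_. 0)" using True kelvin_zero by auto
    thus ?thesis using has_laplacian_const[of 0 x] by (intro exI[of _ "k x"]) (auto simp: w_def)
  next
    case False
    thus ?thesis using lap_kelvin[of r x] k_mono[of r x] r x unfolding w_def p_def
      by (intro exI[of _ "k (inversion r x)"]) auto
  qed
  then obtain j where j: "j \<le> k x" "has_laplacian (kelvin u r) (- j * w powr p) x" by blast
  define L where "L = - k x * u x powr p - (- j * w powr p)"
  have "has_laplacian (\<lambda>x. u x - kelvin u r x) L x"
    unfolding L_def using has_laplacian_diff[OF lap_u[of x, folded p_def] j(2)] .
  moreover have "j * w powr p \<le> k x * w powr p" using j(1) by (intro mult_right_mono) auto
  hence L: "L \<le> k x * (w powr p - u x powr p)" by (simp add: L_def algebra_simps)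
  hence "L \<le> (k0 * p * B powr (p - 1)) * (u x - kelvin u r x)"
    if "u x \<ge> kelvin u r x" "u x \<le> B" for B
  proof -
    have m: "w powr p \<le> u x powr p" using that w p by (intro powr_mono2) (auto simp: w_def)
    have "k x * (w powr p - u x powr p) \<le> k0 * (u x powr p - w powr p)"
    proof -
      have "- k x * (u x powr p - w powr p) \<le> k0 * (u x powr p - w powr p)"
        using k0(2)[of x] m by (intro mult_right_mono) auto
      thus ?thesis by (simp add: algebra_simps)
    qed
    also have "\<dots> \<le> k0 * (p * B powr (p - 1) * (u x - w))"
      using k0 w that p by (intro mult_left_mono powr_diff_le) (auto simp: w_def)
    finally show ?thesis using L by (simp add: w_def mult_ac)
  qed
  moreover have "L \<le> - (k0 * p * B powr (p - 1)) * (u x - kelvin u r x)"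
    if "u x < kelvin u r x" "kelvin u r x \<le> B" for B
  proof -
    have m: "u x powr p \<le> w powr p" using that pos[of x] p by (intro powr_mono2) (auto simp: w_def)
    have "k x * (w powr p - u x powr p) \<le> k0 * (w powr p - u x powr p)"
      using k0(2)[of x] m by (intro mult_right_mono) auto
    also have "\<dots> \<le> k0 * (p * B powr (p - 1) * (w - u x))"
      using k0 pos[of x] that p by (intro mult_left_mono powr_diff_le) (auto simp: w_def)
    finally show ?thesis using L by (simp add: w_def algebra_simps)
  qed
  ultimately show ?thesis using that by blast
qed

definition above :: "real \<Rightarrow> bool" where
  "above r \<longleftrightarrow> (\<forall>x. x \<noteq> 0 \<longrightarrow> norm x \<ge> r \<longrightarrow> kelvin u r x \<le> u x)"

text \<open>On a narrow annulus \<open>1 - C (|x|\<^sup>2 - r\<^sup>2)\<close> is a positive strict supersolution of \<open>\<Delta> + C\<close>, so the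
weak minimum principle applies. It takes the place of a derivative estimate on the sphere of
inversion, where \<open>u\<close> and its transform agree. Its width does not depend on \<open>r\<close>, not even as
\<open>r\<close> tends to \<open>0\<close>.\<close>

lemma narrow_annulus:
  assumes "b > 0"
  obtains \<delta> where "\<delta> > 0"
    "\<And>r R x. 0 < r \<Longrightarrow> r \<le> norm x \<Longrightarrow> norm x \<le> R \<Longrightarrow> R \<le> b \<Longrightarrow> R\<^sup>2 - r\<^sup>2 \<le> \<delta> \<Longrightarrow>
       (\<And>y. norm y = R \<Longrightarrow> kelvin u r y \<le> u y) \<Longrightarrow> kelvin u r x \<le> u x"
proof -
  obtain M where M: "M \<ge> 1" "\<And>x. norm x \<le> b \<Longrightarrow> u x \<le> M" using bound_on_ball by blast
  define C where "C = k0 * p * M powr (p - 1)"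
  have C: "C > 0" using k0(1) p(1) M(1) by (simp add: C_def)
  define \<delta> where "\<delta> = 1 / (2 * C)"
  show ?thesis
  proof (rule that)
    show "\<delta> > 0" using C by (simp add: \<delta>_def)
    fix r R and x :: 'a
    assume r: "0 < r" "r \<le> norm x" "norm x \<le> R" "R \<le> b" "R\<^sup>2 - r\<^sup>2 \<le> \<delta>"
      and bd: "\<And>y. norm y = R \<Longrightarrow> kelvin u r y \<le> u y"
    define A where "A = {y::'a. r \<le> norm y \<and> norm y \<le> R}"
    define \<phi> where "\<phi> = (\<lambda>y::'a. 1 - C * ((norm (y - 0))\<^sup>2 - r\<^sup>2))"
    have A: "A = cball 0 R - ball 0 r" by (auto simp: A_def)
    have "0 \<le> u x - kelvin u r x"
    proof (rule weak_minimum_principle[of A "\<lambda>x. u x - kelvin u r x" \<phi> C])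
      show "compact A" unfolding A by (simp add: compact_diff)
      show "continuous_on A (\<lambda>x. u x - kelvin u r x)"
        by (intro continuous_intros continuous_on_subset[OF cont] continuous_on_subset[OF kelvin_cont])
           (use r in \<open>auto simp: A_def\<close>)
      show "continuous_on A \<phi>" unfolding \<phi>_def by (intro continuous_intros)
      show "x \<in> A" using r by (simp add: A_def)
      fix y
      show "\<phi> y > 0" if "y \<in> A"
      proof -
        have "(norm y)\<^sup>2 \<le> R\<^sup>2" using that by (auto simp: A_def intro!: power_mono)
        hence "C * ((norm y)\<^sup>2 - r\<^sup>2) \<le> C * \<delta>" using C r(5) by (intro mult_left_mono) auto
        also have "\<dots> = 1 / 2" using C by (simp add: \<delta>_def)
        finally show ?thesis by (simp add: \<phi>_def)
      qed
      show "\<exists>M. has_laplacian \<phi> M y \<and> M < - C * \<phi> y" if "y \<in> interior A"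
      proof -
        have "r \<le> norm y" using that interior_subset by (force simp: A_def)
        hence "r\<^sup>2 \<le> (norm y)\<^sup>2" using r by (intro power_mono) auto
        hence "\<phi> y \<le> 1" using C by (simp add: \<phi>_def)
        hence "C * \<phi> y \<le> C" using C by (simp add: mult_left_le)
        moreover have "has_laplacian \<phi> (4 * 0 * (norm (y - 0))\<^sup>2 + 2 * real DIM('a) * (- C)) y"
          unfolding \<phi>_def
          by (rule has_laplacian_radial[where \<phi> = "\<lambda>s. 1 - C * (s - r\<^sup>2)"])
             (auto intro!: derivative_eq_intros always_eventually)
        moreover have "2 * real DIM('a) * (- C) < - C"
          using dim C by (simp add: mult_less_cancel_right1)
        ultimately show ?thesis by (intro exI[of _ "2 * real DIM('a) * (- C)"]) auto
      qed
      assume y: "y \<in> A" and neg: "u y - kelvin u r y < 0"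
      have ny: "r \<le> norm y" "norm y \<le> R" "y \<noteq> 0" using y r by (auto simp: A_def)
      have "norm y \<noteq> R" using bd neg by force
      moreover have "norm y \<noteq> r" using kelvin_on_sphere[of y r u] r neg by auto
      ultimately have "y \<in> ball 0 R - cball 0 r" using ny by auto
      moreover have "open (ball 0 R - cball 0 r :: 'a set)" by (simp add: open_Diff)
      moreover have "ball 0 R - cball 0 r \<subseteq> A" by (auto simp: A_def)
      ultimately have int: "y \<in> interior A" using interiorI by blast
      have "kelvin u r y \<le> (r / norm y) ^ (DIM('a) - 2) * M"
        by (rule kelvin_le) (use M ny r in auto)
      also have "\<dots> \<le> 1 * M" using M ny r by (intro mult_right_mono power_le_one) (auto simp: divide_le_eq_1)
      finally have "kelvin u r y \<le> M" by simp
      moreover obtain L where "has_laplacian (\<lambda>x. u x - kelvin u r x) L y"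
        "\<And>B. u y < kelvin u r y \<Longrightarrow> kelvin u r y \<le> B \<Longrightarrow> L \<le> - (k0 * p * B powr (p - 1)) * (u y - kelvin u r y)"
        using difference_laplacian[of r y] ny r by (metis less_imp_le)
      ultimately show "y \<in> interior A \<and> (\<exists>L. has_laplacian (\<lambda>x. u x - kelvin u r x) L y \<and>
          L \<le> - C * (u y - kelvin u r y))"
        using int neg by (auto simp: C_def)
    qed
    thus "kelvin u r x \<le> u x" by simp
  qed
qed

text \<open>If \<open>u\<close> coincided with its transform, the two equations would give \<open>k (inversion r y) = k y\<close>
throughout the exterior; otherwise the strong minimum principle applies, as the exterior is
connected.\<close>

lemma strictly_above:
  assumes r: "r \<ge> 0" and ab: "above r"
    and nonconst: "r > 0 \<Longrightarrow> \<exists>x. norm x > r \<and> k (inversion r x) \<noteq> k x"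
    and x: "norm x > r"
  shows "kelvin u r x < u x"
proof (cases "r = 0")
  case True
  thus ?thesis using pos[of x] kelvin_zero by simp
next
  case False
  hence r: "r > 0" using r by simp
  obtain M where M: "M \<ge> 1" "\<And>x. norm x \<le> r \<Longrightarrow> u x \<le> M" using bound_on_ball by blast
  define W where "W = - cball (0::'a) r"
  define C where "C = k0 * p * (M + 1) powr (p - 1)"
  have "(\<forall>x\<in>W. u x - kelvin u r x > 0) \<or> (\<forall>x\<in>W. u x - kelvin u r x = 0)"
  proof (rule strong_minimum_principle[where C = C])
    show "open W" by (simp add: W_def open_Compl)
    show "connected W" unfolding W_def using dim by (intro connected_complement_bounded_convex) auto
    show "continuous_on W (\<lambda>x. u x - kelvin u r x)"
      by (intro continuous_intros continuous_on_subset[OF cont] continuous_on_subset[OF kelvin_cont])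
         (use r in \<open>auto simp: W_def\<close>)
    show "C > 0" using k0(1) p(1) M(1) by (simp add: C_def)
    fix y assume "y \<in> W"
    hence y: "norm y > r" "y \<noteq> 0" using r by (auto simp: W_def)
    show nn: "0 \<le> u y - kelvin u r y" using ab y by (simp add: above_def)
    have "kelvin u r y \<le> (r / norm y) ^ (DIM('a) - 2) * M"
      by (rule kelvin_le) (use M y r in auto)
    also have "\<dots> \<le> 1 * M" using M y r by (intro mult_right_mono power_le_one) (auto simp: divide_le_eq_1)
    finally have "kelvin u r y \<le> M" by simp
    moreover obtain L where "has_laplacian (\<lambda>x. u x - kelvin u r x) L y"
      "\<And>B. u y \<ge> kelvin u r y \<Longrightarrow> u y \<le> B \<Longrightarrow> L \<le> (k0 * p * B powr (p - 1)) * (u y - kelvin u r y)"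
      using difference_laplacian[of r y] y r by (metis less_imp_le)
    ultimately show "\<exists>L. has_laplacian (\<lambda>x. u x - kelvin u r x) L y \<and>
       (u y - kelvin u r y \<le> 1 \<longrightarrow> L \<le> C * (u y - kelvin u r y))"
      using nn by (intro exI[of _ L]) (auto simp: C_def)
  qed
  moreover have "\<not> (\<forall>x\<in>W. u x - kelvin u r x = 0)"
  proof
    assume eq: "\<forall>x\<in>W. u x - kelvin u r x = 0"
    obtain y where y: "norm y > r" "k (inversion r y) \<noteq> k y" using nonconst[OF r] by blast
    have y0: "y \<noteq> 0" "y \<in> W" using y r by (auto simp: W_def)
    have "\<forall>\<^sub>F w in nhds y. w \<in> W" using y0 eventually_nhds_in_open[of W y] by (simp add: W_def open_Compl)
    hence "\<forall>\<^sub>F w in nhds y. u w - kelvin u r w = 0" using eq by (auto elim: eventually_mono)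
    from has_laplacian_cong[OF has_laplacian_diff[OF lap_u lap_kelvin[OF r y0(1)]] this]
    have l: "has_laplacian (\<lambda>_. 0) (- k y * u y powr p - (- k (inversion r y) * kelvin u r y powr p)) y"
      by (simp add: p_def)
    \<comment> \<open>the nonnegative Laplacian of the zero function bounds \<open>k y\<close> by its reflected value,
      and monotonicity of \<open>k\<close> is the reverse inequality\<close>
    have "kelvin u r y = u y" using eq y0 by simp
    from laplacian_nonneg_at_min[OF l] this have "(k (inversion r y) - k y) * u y powr p \<ge> 0"
      by (simp add: algebra_simps)
    hence "k (inversion r y) \<ge> k y" using pos[of y] by (simp add: zero_le_mult_iff)
    thus False using k_mono[of r y] r y by simp
  qed
  ultimately show ?thesis using x by (auto simp: W_def)
qed

text \<open>Once \<open>u\<close> lies strictly above the transform for \<open>r\<close>, it stays above for slightly larger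
parameters. Away from the sphere of radius \<open>r\<close> the gap is at least \<open>c |x| powr (2 - n)\<close>, even at
infinity, while by uniform continuity the transform changes by less than that; the remaining
annulus is narrow. For \<open>r = 0\<close> this starts the whole process.\<close>

lemma above_open:
  assumes r: "r \<ge> 0" and ab: "above r"
    and nonconst: "r > 0 \<Longrightarrow> \<exists>x. norm x > r \<and> k (inversion r x) \<noteq> k x"
  obtains \<epsilon> where "\<epsilon> > 0" "\<And>t. r \<le> t \<Longrightarrow> t < r + \<epsilon> \<Longrightarrow> above t"
proof -
  define N where "N = DIM('a) - 2"
  have N: "real N = real DIM('a) - 2" "N > 0" using dim by (auto simp: N_def of_nat_diff)
  obtain \<delta> where \<delta>: "\<delta> > 0"
    "\<And>t R x. 0 < t \<Longrightarrow> t \<le> norm x \<Longrightarrow> norm x \<le> R \<Longrightarrow> R \<le> r + 1 \<Longrightarrow> R\<^sup>2 - t\<^sup>2 \<le> \<delta> \<Longrightarrow>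
       (\<And>y. norm y = R \<Longrightarrow> kelvin u t y \<le> u y) \<Longrightarrow> kelvin u t x \<le> u x"
    using narrow_annulus[of "r + 1"] r by auto
  define R where "R = min (r + 1) (sqrt (r\<^sup>2 + \<delta>))"
  have "r < sqrt (r\<^sup>2 + \<delta>)" using \<delta>(1) by (intro real_less_rsqrt) auto
  hence R: "R > r" "R \<le> r + 1" by (auto simp: R_def)
  hence R0: "R > 0" using r by linarith
  have "R\<^sup>2 \<le> (sqrt (r\<^sup>2 + \<delta>))\<^sup>2" using R R0 by (intro power_mono) (auto simp: R_def)
  hence R2: "R\<^sup>2 \<le> r\<^sup>2 + \<delta>" using \<delta>(1) by simp
  obtain M where M: "M \<ge> 1" "\<And>x. norm x \<le> r \<Longrightarrow> u x \<le> M" using bound_on_ball by blast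
  \<comment> \<open>\<open>u x \<le> B |x| powr (2 - n)\<close> holds wherever the gap is at most \<open>|x| powr (2 - n)\<close>\<close>
  define B where "B = r ^ N * M + 1"
  have B: "B > 0" using r M by (simp add: B_def add_nonneg_pos)
  define C where "C = k0 * p * B powr (p - 1)"
  have C: "C > 0" using k0(1) p(1) B by (simp add: C_def)
  have "\<exists>c>0. \<forall>x. norm x \<ge> R \<longrightarrow> u x - kelvin u r x \<ge> c * (1 / norm x) ^ (DIM('a) - 2)"
  proof (rule positive_supersolution_at_infinity[OF dim R0 _ _ C])
    show "continuous_on {x. R \<le> norm x} (\<lambda>x. u x - kelvin u r x)"
      by (intro continuous_intros continuous_on_subset[OF cont] continuous_on_subset[OF kelvin_cont])
         (use R0 in auto)
    show "0 < u x - kelvin u r x" if "R \<le> norm x" for x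
      using strictly_above[OF r ab nonconst] that R by simp
    fix x :: 'a assume x: "R < norm x"
    hence x0: "x \<noteq> 0" "norm x \<ge> r" "norm x > 0" using R R0 r by auto
    define W where "W = (1 / norm x) ^ N"
    have "kelvin u r x \<le> (r / norm x) ^ N * M" unfolding N_def
      by (rule kelvin_le) (use M x0 r in auto)
    hence kw: "kelvin u r x \<le> r ^ N * M * W" by (simp add: W_def power_divide)
    obtain L where L: "has_laplacian (\<lambda>x. u x - kelvin u r x) L x"
      "\<And>B. u x \<ge> kelvin u r x \<Longrightarrow> u x \<le> B \<Longrightarrow> L \<le> (k0 * p * B powr (p - 1)) * (u x - kelvin u r x)"
      using difference_laplacian[of r x] x0 r by metis
    have "L \<le> C / norm x ^ 4 * (u x - kelvin u r x)" if "u x - kelvin u r x \<le> W"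
    proof -
      have "u x \<le> B * W" using that kw by (simp add: B_def algebra_simps)
      hence "L \<le> (k0 * p * (B * W) powr (p - 1)) * (u x - kelvin u r x)"
        using L(2) ab x0 by (simp add: above_def)
      moreover have "W powr (p - 1) = 1 / norm x ^ 4"
      proof -
        have "W = norm x powr (- real N)"
          using x0 by (simp add: W_def powr_minus powr_realpow power_divide inverse_eq_divide)
        hence "W powr (p - 1) = norm x powr (- real N * (p - 1))" by (simp add: powr_powr)
        also have "- real N * (p - 1) = - 4" using N by (simp add: p(2) flip: N(1))
        finally show ?thesis using x0 by (simp add: powr_minus inverse_eq_divide)
      qed
      moreover have "(B * W) powr (p - 1) = B powr (p - 1) * W powr (p - 1)"
        using B by (simp add: powr_mult W_def)
      ultimately show ?thesis by (simp add: C_def)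
    qed
    thus "\<exists>L. has_laplacian (\<lambda>x. u x - kelvin u r x) L x \<and>
        (u x - kelvin u r x \<le> (1 / norm x) ^ (DIM('a) - 2) \<longrightarrow> L \<le> C / norm x ^ 4 * (u x - kelvin u r x))"
      using L(1) by (auto simp: W_def N_def)
  qed
  then obtain c where c: "c > 0"
    "\<And>x. norm x \<ge> R \<Longrightarrow> u x - kelvin u r x \<ge> c * (1 / norm x) ^ N" unfolding N_def by blast
  \<comment> \<open>uniform continuity in \<open>r\<close> and in the inverted point, which ranges over a compact ball\<close>
  define F where "F = (\<lambda>(t, y::'a). t ^ N * u (t\<^sup>2 *\<^sub>R y))"
  have "continuous_on ({0..r+1} \<times> cball 0 (1/R)) F"
    unfolding F_def case_prod_beta
    by (intro continuous_intros continuous_on_compose2[OF cont]) auto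
  hence "uniformly_continuous_on ({0..r+1} \<times> cball 0 (1/R)) F"
    by (intro compact_uniformly_continuous compact_Times) auto
  then obtain d where d: "d > 0"
    "\<And>a b. a \<in> {0..r+1} \<times> cball 0 (1/R) \<Longrightarrow> b \<in> {0..r+1} \<times> cball 0 (1/R) \<Longrightarrow>
       dist a b < d \<Longrightarrow> dist (F a) (F b) < c"
    using c(1) unfolding uniformly_continuous_on_def by (metis dist_commute)
  define \<epsilon> where "\<epsilon> = min d (R - r)"
  show ?thesis
  proof (rule that)
    show "\<epsilon> > 0" using d R by (simp add: \<epsilon>_def)
    fix t assume t: "r \<le> t" "t < r + \<epsilon>"
    show "above t"
    proof (cases "t = r")
      case True thus ?thesis using ab by simp
    next
      case False
      hence t0: "t > 0" "t < R" "t - r < d" using t r by (auto simp: \<epsilon>_def)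
      have far: "kelvin u t x \<le> u x" if x: "norm x \<ge> R" for x
      proof -
        define y where "y = (1 / (norm x)\<^sup>2) *\<^sub>R x"
        have nx: "norm x > 0" using x R0 by linarith
        have "norm y = 1 / norm x" using nx by (simp add: y_def power2_eq_square)
        also have "\<dots> \<le> 1 / R" using x R0 nx by (intro divide_left_mono) auto
        finally have y: "y \<in> cball 0 (1/R)" by simp
        have "dist (F (t, y)) (F (r, y)) < c"
          by (rule d(2)) (use y t0 t r R in \<open>auto simp: dist_Pair_Pair dist_real_def\<close>)
        hence "F (t, y) \<le> F (r, y) + c" by (simp add: dist_real_def abs_less_iff)
        hence "(1 / norm x) ^ N * F (t, y) \<le> (1 / norm x) ^ N * (F (r, y) + c)"
          by (intro mult_left_mono) auto
        moreover have "kelvin u s x = (1 / norm x) ^ N * F (s, y)" for s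
          unfolding kelvin_rescaled N_def F_def y_def by simp
        ultimately have "kelvin u t x \<le> kelvin u r x + c * (1 / norm x) ^ N"
          by (simp add: algebra_simps)
        thus ?thesis using c(2)[OF x] by linarith
      qed
      have "r\<^sup>2 \<le> t\<^sup>2" using t r by (intro power_mono) auto
      hence "R\<^sup>2 - t\<^sup>2 \<le> \<delta>" using R2 by simp
      hence "kelvin u t x \<le> u x" if "t \<le> norm x" for x
        using \<delta>(2)[of t x R] far[of x] far t0 R that by (cases "norm x \<le> R") auto
      thus ?thesis by (simp add: above_def)
    qed
  qed
qed

lemma above_closed:
  assumes r: "r > 0" and ab: "\<And>t. 0 \<le> t \<Longrightarrow> t < r \<Longrightarrow> above t"
  shows "above r"
  unfolding above_def
proof (intro allI impI)
  fix x :: 'a assume x: "x \<noteq> 0" "r \<le> norm x"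
  have "continuous_on UNIV (\<lambda>t. kelvin u t x)"
    unfolding kelvin_def inversion_def
    by (intro continuous_intros continuous_on_compose2[OF cont]) (use x in auto)
  hence "isCont (\<lambda>t. kelvin u t x) r" by (simp add: continuous_on_eq_continuous_at)
  hence "((\<lambda>t. kelvin u t x) \<longlongrightarrow> kelvin u r x) (at_left r)"
    unfolding isCont_def by (rule filterlim_mono) (auto intro: at_le)
  moreover have "\<forall>\<^sub>F t in at_left r. kelvin u t x \<le> u x"
    using eventually_at_left_real[OF r]
    by eventually_elim (use ab x in \<open>auto simp: above_def\<close>)
  ultimately show "kelvin u r x \<le> u x"
    by (intro tendsto_upperbound) auto
qed

text \<open>The admissible parameters form a subset of \<open>[0, \<infinity>)\<close> that contains \<open>0\<close>, is closed under limits from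
the left and can always be extended to the right; the infimum of the inadmissible ones would be
contradictory.\<close>

lemma above_all:
  assumes nonconst: "\<And>r. r > 0 \<Longrightarrow> \<exists>x. norm x > r \<and> k (inversion r x) \<noteq> k x"
    and r: "r \<ge> 0"
  shows "above r"
proof (rule ccontr)
  assume neg: "\<not> above r"
  define X where "X = {t. t \<ge> 0 \<and> \<not> above t}"
  define s where "s = Inf X"
  have X: "X \<noteq> {}" "bdd_below X" using neg r by (auto simp: X_def intro!: bdd_belowI[of _ 0])
  have s0: "s \<ge> 0" unfolding s_def by (rule cInf_greatest[OF X(1)]) (auto simp: X_def)
  have below: "above t" if "0 \<le> t" "t < s" for t
    using cInf_lower[OF _ X(2), of t] that by (force simp: s_def X_def)
  have "above s"
  proof (cases "s = 0")
    case True
    thus ?thesis using kelvin_zero pos by (simp add: above_def less_imp_le)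
  qed (use above_closed[OF _ below] s0 in auto)
  then obtain \<epsilon> where e: "\<epsilon> > 0" "\<And>t. s \<le> t \<Longrightarrow> t < s + \<epsilon> \<Longrightarrow> above t"
    using above_open[OF s0] nonconst by blast
  have "s + \<epsilon> \<le> Inf X"
  proof (rule cInf_greatest[OF X(1)])
    fix t assume t: "t \<in> X"
    hence "s \<le> t" using X(2) by (simp add: s_def cInf_lower)
    thus "s + \<epsilon> \<le> t" using e(2)[of t] t by (force simp: X_def)
  qed
  thus False using e(1) by (simp add: s_def)
qed

text \<open>Reflection in the sphere of radius \<open>sqrt |x|\<close> sends \<open>x\<close> to the unit vector \<open>x / |x|\<close>.\<close>

theorem decay_at_most_critical:
  assumes nonconst: "\<And>r. r > 0 \<Longrightarrow> \<exists>x. norm x > r \<and> k (inversion r x) \<noteq> k x"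
    and x: "norm x \<ge> 1"
  shows "u x \<ge> norm x powr (- ((real DIM('a) - 2) / 2)) * u ((1 / norm x) *\<^sub>R x)"
proof -
  define r where "r = sqrt (norm x)"
  have r: "r > 0" "r\<^sup>2 = norm x" using x by (auto simp: r_def)
  have "x \<noteq> 0" using x by auto
  have "1 \<le> r" using x by (simp add: r_def)
  hence "r \<le> r\<^sup>2" by (simp add: power2_eq_square)
  hence "r \<le> norm x" using r by simp
  have "above r" by (rule above_all) (use nonconst r in auto)
  hence "kelvin u r x \<le> u x" using \<open>r \<le> norm x\<close> \<open>x \<noteq> 0\<close> by (simp add: above_def)
  moreover have "inversion r x = (1 / norm x) *\<^sub>R x"
    using r x by (simp add: inversion_def power_divide power2_eq_square)
  moreover have "(r / norm x) ^ (DIM('a) - 2) = norm x powr (- ((real DIM('a) - 2) / 2))"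
  proof -
    have "r / norm x = 1 / r" using r by (simp flip: r(2) add: power2_eq_square)
    thus ?thesis using inverse_power_eq_powr[OF r(1), of "DIM('a) - 2"] r dim by (simp add: of_nat_diff)
  qed
  ultimately show ?thesis by (simp add: kelvin_def)
qed

end

section \<open>Stereographic pull-back of the Laplacian\<close>

lemma has_derivative_sphere_deriv:
  assumes p: "p \<in> unit_sphere" and f: "f differentiable (at p within unit_sphere)"
  shows "(f has_derivative sphere_deriv f p) (at p within unit_sphere)"
proof -
  obtain D where D: "(f has_derivative D) (at p within unit_sphere)"
    using f by (auto simp: differentiable_def)
  have "(f has_derivative D) (at ((\<lambda>x. x) p) within (\<lambda>x. x) ` unit_sphere)" using D by simp
  from diff_chain_within[OF has_derivative_tproj[OF p] this]
  show ?thesis unfolding sphere_deriv_eq[OF p D] by (simp add: o_def)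
qed

lemma linear_sphere_deriv:
  assumes "p \<in> unit_sphere" "f differentiable (at p within unit_sphere)"
  shows "linear (sphere_deriv f p)"
  using has_derivative_sphere_deriv[OF assms] has_derivative_bounded_linear bounded_linear.linear by blast

lemma sphere_deriv_normal:
  assumes p: "p \<in> unit_sphere" and f: "f differentiable (at p within unit_sphere)"
  shows "sphere_deriv f p p = 0"
proof -
  obtain D where D: "(f has_derivative D) (at p within unit_sphere)"
    using f by (auto simp: differentiable_def)
  have "linear D" using D has_derivative_bounded_linear bounded_linear.linear by blast
  thus ?thesis using p by (simp add: sphere_deriv_eq[OF p D] tproj_def norm_eq_1 linear_0)
qed

lemma sphere_curve_has_vector_derivative:
  assumes c: "range c \<subseteq> unit_sphere" "(c has_vector_derivative c') (at t)"
    and f: "f differentiable (at (c t) within unit_sphere)"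
  shows "((\<lambda>t. f (c t)) has_vector_derivative sphere_deriv f (c t) c') (at t)"
proof -
  have ct: "c t \<in> unit_sphere" using c(1) by blast
  note D = has_derivative_sphere_deriv[OF ct f]
  have "(f has_derivative sphere_deriv f (c t)) (at (c t) within range c)"
    by (rule has_derivative_subset[OF D c(1)])
  from diff_chain_within[OF c(2)[unfolded has_vector_derivative_def] this]
  show ?thesis using linear_sphere_deriv[OF ct f]
    by (simp add: has_vector_derivative_def o_def linear_cmul)
qed

lemma sphere_grad_inner:
  assumes "p \<in> unit_sphere" "f differentiable (at p within unit_sphere)"
  shows "sphere_grad f p \<bullet> h = sphere_deriv f p h"
proof -
  note lin = linear_sphere_deriv[OF assms]
  have "sphere_deriv f p h = sphere_deriv f p (\<Sum>b\<in>Basis. (h \<bullet> b) *\<^sub>R b)"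
    by (simp add: euclidean_representation)
  also have "\<dots> = (\<Sum>b\<in>Basis. (h \<bullet> b) * sphere_deriv f p b)"
    by (simp add: linear_sum[OF lin] linear_cmul[OF lin])
  also have "\<dots> = sphere_grad f p \<bullet> h"
    unfolding sphere_grad_def inner_sum_left by (intro sum.cong) (simp_all add: inner_commute)
  finally show ?thesis by simp
qed

lemma tproj_inner: "tproj p a \<bullet> b = a \<bullet> tproj p b"
  by (simp add: tproj_def inner_diff_left inner_diff_right inner_commute)

text \<open>The divergence is the trace of the tangential derivative, and tangent vectors \<open>e i\<close> with this
property compute that trace up to the factor \<open>\<mu>\<close>. The images of the coordinate vectors under a
conformal map are such vectors.\<close>

lemma sphere_div_conformal_frame:
  fixes X :: "'b::euclidean_space \<Rightarrow> 'b"
  assumes "p \<in> unit_sphere" "X differentiable (at p within unit_sphere)"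
    and frame: "\<And>h. (\<Sum>i\<in>I. (e i \<bullet> h) *\<^sub>R e i) = \<mu> *\<^sub>R tproj p h"
  shows "(\<Sum>i\<in>I. sphere_deriv X p (e i) \<bullet> e i) = \<mu> * sphere_div X p"
proof -
  define E where "E = sphere_deriv X p"
  have lin: "linear E" unfolding E_def by (rule linear_sphere_deriv[OF assms(1,2)])
  have "E (e i) = (\<Sum>b\<in>Basis. (e i \<bullet> b) *\<^sub>R E b)" for i
  proof -
    have "E (e i) = E (\<Sum>b\<in>Basis. (e i \<bullet> b) *\<^sub>R b)" by (simp add: euclidean_representation)
    thus ?thesis by (simp add: linear_sum[OF lin] linear_cmul[OF lin])
  qed
  hence "(\<Sum>i\<in>I. E (e i) \<bullet> e i) = (\<Sum>i\<in>I. \<Sum>b\<in>Basis. (e i \<bullet> b) * (E b \<bullet> e i))"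
    by (simp add: inner_sum_left)
  also have "\<dots> = (\<Sum>b\<in>Basis. E b \<bullet> (\<Sum>i\<in>I. (e i \<bullet> b) *\<^sub>R e i))"
    by (subst sum.swap) (simp add: inner_sum_right)
  also have "\<dots> = \<mu> * (\<Sum>b\<in>Basis. tproj p (E b) \<bullet> b)"
    by (simp add: frame tproj_inner sum_distrib_left)
  finally show ?thesis by (simp add: E_def sphere_div_def sphere_cov_deriv_def)
qed

text \<open>An inversion centred at the pole \<open>(0, \<sigma>)\<close>: relative to that pole \<open>x\<close> is placed at \<open>Y = (x, - a \<sigma>)\<close> and
sent to \<open>2 a Y / |Y|\<^sup>2\<close>, where \<open>|Y|\<^sup>2 = |x|\<^sup>2 + a\<^sup>2\<close>. The scale \<open>a\<close> and the sign \<open>\<sigma>\<close> allow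
one formula to cover the projection from the north pole (\<open>a = \<sigma> = 1\<close>) and its composition with the
inversion of radius \<open>r\<close> (\<open>a = r\<^sup>2\<close>, \<open>\<sigma> = -1\<close>).\<close>

definition stereo :: "real \<Rightarrow> real \<Rightarrow> 'a::euclidean_space \<Rightarrow> 'a \<times> real" where
  "stereo a \<sigma> x = (0, \<sigma>) + (2 * a / ((norm x)\<^sup>2 + a\<^sup>2)) *\<^sub>R (x, - a * \<sigma>)"

lemma stereo_sphere:
  assumes "a > 0" "\<sigma>\<^sup>2 = 1"
  shows "stereo a \<sigma> x \<in> unit_sphere"
proof -
  define q where "q = (norm x)\<^sup>2 + a\<^sup>2"
  have q: "q > 0" "(norm x)\<^sup>2 = q - a\<^sup>2" using assms by (auto simp: q_def add_nonneg_pos)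
  have "stereo a \<sigma> x \<bullet> stereo a \<sigma> x =
      (2 * a / q)\<^sup>2 * (x \<bullet> x) + \<sigma>\<^sup>2 * (1 - 2 * a\<^sup>2 / q)\<^sup>2"
    unfolding stereo_def q_def[symmetric]
    by (simp add: inner_prod_def algebra_simps power2_eq_square)
  also have "\<dots> = 1" unfolding assms(2) q(2)[unfolded power2_norm_eq_inner] using q(1)
    by (simp add: field_simps power2_eq_square)
  finally show ?thesis by (simp add: norm_eq_1)
qed

lemma stereo_cont:
  assumes "a > 0" shows "continuous_on A (stereo a \<sigma>)"
proof -
  have "(norm x)\<^sup>2 + a\<^sup>2 \<noteq> 0" for x :: 'a using assms by (simp add: add_nonneg_eq_0_iff)
  thus ?thesis unfolding stereo_def by (intro continuous_intros) auto
qed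

text \<open>The vectors \<open>e b\<close> are the partial derivatives of \<open>stereo a \<sigma>\<close>: multiples by \<open>2 a / q\<close> of the
reflections of the coordinate vectors in the hyperplane orthogonal to \<open>Y\<close>. That reflection takes the
vertical direction to the normal of the sphere, which leaves the projection onto the
tangent space.\<close>

lemma stereo_frame:
  fixes x :: "'a::euclidean_space" and h :: "'a \<times> real"
  assumes a: "a > 0" "\<sigma>\<^sup>2 = 1"
  defines "q \<equiv> (norm x)\<^sup>2 + a\<^sup>2"
  defines "e \<equiv> \<lambda>b. (2 * a / q) *\<^sub>R (b, 0) - (4 * a * (x \<bullet> b) / q\<^sup>2) *\<^sub>R (x, - a * \<sigma>)"
  shows "(\<Sum>b\<in>Basis. (e b \<bullet> h) *\<^sub>R e b) = (2 * a / q)\<^sup>2 *\<^sub>R tproj (stereo a \<sigma> x) h"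
proof -
  have q: "q > 0" "x \<bullet> x = q - a\<^sup>2"
    using a by (auto simp: q_def add_nonneg_pos power2_norm_eq_inner)
  obtain \<alpha> \<beta> where h: "h = (\<alpha>, \<beta>)" by (cases h)
  define \<kappa> where "\<kappa> = x \<bullet> \<alpha> - a * \<sigma> * \<beta>"
  define w where "w = \<alpha> - (2 * \<kappa> / q) *\<^sub>R x"
  have eh: "e b \<bullet> h = (2 * a / q) * (w \<bullet> b)" for b
    using q(1) unfolding e_def h w_def \<kappa>_def
    by (simp add: inner_prod_def inner_diff_left inner_diff_right inner_commute)
       (simp add: field_simps power2_eq_square)
  have "(\<Sum>b\<in>Basis. (w \<bullet> b) *\<^sub>R e b) =
     (2 * a / q) *\<^sub>R (w, 0) - (4 * a * (x \<bullet> w) / q\<^sup>2) *\<^sub>R (x, - a * \<sigma>)"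
  proof -
    have "(\<Sum>b\<in>Basis. (w \<bullet> b) *\<^sub>R e b) = (\<Sum>b\<in>Basis. (2 * a / q) *\<^sub>R ((w \<bullet> b) *\<^sub>R b, 0) -
       ((w \<bullet> b) * (x \<bullet> b)) *\<^sub>R (4 * a / q\<^sup>2) *\<^sub>R (x, - a * \<sigma>))"
      unfolding e_def by (intro sum.cong) (auto simp: algebra_simps)
    also have "\<dots> = (2 * a / q) *\<^sub>R (\<Sum>b\<in>Basis. ((w \<bullet> b) *\<^sub>R b, 0)) -
       (\<Sum>b\<in>Basis. (w \<bullet> b) * (x \<bullet> b)) *\<^sub>R (4 * a / q\<^sup>2) *\<^sub>R (x, - a * \<sigma>)"
      by (simp only: sum_subtractf scaleR_sum_right scaleR_sum_left)
    also have "(\<Sum>b\<in>Basis. ((w \<bullet> b) *\<^sub>R b, 0::real)) = (w, 0)"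
      by (simp add: sum_prod euclidean_representation)
    also have "(\<Sum>b\<in>Basis. (w \<bullet> b) * (x \<bullet> b)) = x \<bullet> w"
      by (subst euclidean_inner) (simp add: mult.commute)
    finally show ?thesis by (simp add: algebra_simps)
  qed
  moreover have "(\<Sum>b\<in>Basis. (e b \<bullet> h) *\<^sub>R e b) = (2 * a / q) *\<^sub>R (\<Sum>b\<in>Basis. (w \<bullet> b) *\<^sub>R e b)"
    unfolding eh by (simp only: scaleR_sum_right scaleR_scaleR)
  ultimately have "(\<Sum>b\<in>Basis. (e b \<bullet> h) *\<^sub>R e b) =
     (2 * a / q) *\<^sub>R ((2 * a / q) *\<^sub>R (w, 0) - (4 * a * (x \<bullet> w) / q\<^sup>2) *\<^sub>R (x, - a * \<sigma>))"
    by simp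
  also have "\<dots> = (2 * a / q)\<^sup>2 *\<^sub>R ((w, 0) - (2 * (x \<bullet> w) / q) *\<^sub>R (x, - a * \<sigma>))"
    using q(1) by (simp add: algebra_simps power2_eq_square)
  also have "(w, 0) - (2 * (x \<bullet> w) / q) *\<^sub>R (x, - a * \<sigma>) = tproj (stereo a \<sigma> x) h"
  proof -
    have xw: "x \<bullet> w = x \<bullet> \<alpha> - 2 * \<kappa> * (q - a\<^sup>2) / q"
      by (simp add: w_def inner_diff_right q(2))
    have ph: "stereo a \<sigma> x \<bullet> h = \<sigma> * \<beta> + 2 * a * \<kappa> / q"
      unfolding stereo_def q_def[symmetric] h \<kappa>_def by (simp add: inner_prod_def algebra_simps diff_divide_distrib)
    have xa: "x \<bullet> \<alpha> = \<kappa> + a * \<sigma> * \<beta>" by (simp add: \<kappa>_def)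
    have 1: "2 * \<kappa> / q + 2 * (x \<bullet> w) / q = (\<sigma> * \<beta> + 2 * a * \<kappa> / q) * (2 * a / q)"
      unfolding xw xa using q(1) by (simp add: field_simps power2_eq_square)
    have 2: "2 * (x \<bullet> w) / q * (a * \<sigma>) = \<beta> - (\<sigma> * \<beta> + 2 * a * \<kappa> / q) * (\<sigma> - 2 * a\<^sup>2 * \<sigma> / q)"
    proof -
      have "\<beta> - (\<sigma> * \<beta> + 2 * a * \<kappa> / q) * (\<sigma> - 2 * a\<^sup>2 * \<sigma> / q) =
         \<beta> - \<sigma>\<^sup>2 * \<beta> * (1 - 2 * a\<^sup>2 / q) - 2 * a * \<kappa> * \<sigma> / q * (1 - 2 * a\<^sup>2 / q)"
        using q(1) by (simp add: field_simps power2_eq_square)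
      also have "\<dots> = 2 * a\<^sup>2 * \<beta> / q - 2 * a * \<kappa> * \<sigma> / q * (1 - 2 * a\<^sup>2 / q)"
        unfolding a(2) by (simp add: algebra_simps)
      also have "\<dots> = 2 * a\<^sup>2 * \<sigma>\<^sup>2 * \<beta> / q - 2 * a * \<kappa> * \<sigma> / q * (1 - 2 * a\<^sup>2 / q)"
        unfolding a(2) by simp
      also have "\<dots> = 2 * (x \<bullet> w) / q * (a * \<sigma>)"
        unfolding xw xa using q(1) by (simp add: field_simps power2_eq_square)
      finally show ?thesis by simp
    qed
    have "tproj (stereo a \<sigma> x) h = (\<alpha>, \<beta>) - (\<sigma> * \<beta> + 2 * a * \<kappa> / q) *\<^sub>R ((2 * a / q) *\<^sub>R x, \<sigma> - 2 * a\<^sup>2 * \<sigma> / q)"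
      unfolding tproj_def ph by (simp add: stereo_def h q_def power2_eq_square)
    also have "\<dots> = (\<alpha> - (2 * \<kappa> / q + 2 * (x \<bullet> w) / q) *\<^sub>R x, 2 * (x \<bullet> w) / q * (a * \<sigma>))"
      unfolding 1 2 by simp
    also have "\<dots> = (w, 0) - (2 * (x \<bullet> w) / q) *\<^sub>R (x, - a * \<sigma>)"
      by (simp add: w_def scaleR_add_left)
    finally show ?thesis by simp
  qed
  finally show ?thesis .
qed

text \<open>Conformal covariance of \<open>\<Delta> - n (n - 2) / 4\<close> under stereographic projection. Differentiating
\<open>\<rho> (v \<circ> stereo a \<sigma>)\<close> twice along each coordinate line and summing up gives three contributions. The
one with second derivatives of \<open>v\<close> is the Laplacian on the sphere by the frame property; the one
without derivatives of \<open>v\<close> is the Laplacian of \<open>\<rho>\<close>; and in the first order one the gradient of \<open>v\<close>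
is paired with a multiple of the normal vector, so it vanishes. The last fact is what fixes the power of
the conformal factor.\<close>

lemma has_laplacian_stereo_pullback:
  fixes x :: "'a::euclidean_space" and v :: "'a \<times> real \<Rightarrow> real"
  assumes a: "a > 0" "\<sigma>\<^sup>2 = 1"
    and v: "C2_on_sphere U v"
    and U: "\<forall>\<^sub>F y in nhds x. stereo a \<sigma> y \<in> U"
  defines "n \<equiv> real DIM('a)"
  defines "\<mu> \<equiv> \<lambda>y::'a. 2 * a / ((norm y)\<^sup>2 + a\<^sup>2)"
  shows "has_laplacian (\<lambda>y. \<mu> y powr ((n - 2) / 2) * v (stereo a \<sigma> y))
     (\<mu> x powr ((n + 2) / 2) *
        (sphere_laplacian v (stereo a \<sigma> x) - n * (n - 2) / 4 * v (stereo a \<sigma> x))) x"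
proof -
  define m where "m = (n - 2) / 2"
  define q where "q = (norm x)\<^sup>2 + a\<^sup>2"
  define Y where "Y = (x, - a * \<sigma>)"
  define P where "P = stereo a \<sigma> x"
  define g where "g = sphere_grad v"
  define E where "E = sphere_deriv g P"
  define A where "A = (2 * a) powr m"
  define Q where "Q = (\<lambda>b t. q + 2 * t * (x \<bullet> b) + t\<^sup>2)"
  define Q1 where "Q1 = (\<lambda>b t. 2 * (x \<bullet> b) + 2 * t)"
  \<comment> \<open>the image of the coordinate line in direction \<open>b\<close>, with its first two derivatives\<close>
  define c where "c = (\<lambda>b t. stereo a \<sigma> (x + t *\<^sub>R b))"
  define c1 where "c1 = (\<lambda>b t. (2 * a / Q b t) *\<^sub>R (b, 0) -
      (2 * a * Q1 b t / (Q b t)\<^sup>2) *\<^sub>R (Y + t *\<^sub>R (b, 0)))"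
  define c2 where "c2 = (\<lambda>b. (- 8 * a * (x \<bullet> b) / q\<^sup>2) *\<^sub>R (b, 0) +
      (- 4 * a / q\<^sup>2 + 16 * a * (x \<bullet> b)\<^sup>2 / q^3) *\<^sub>R Y)"
  \<comment> \<open>the conformal factor along that line, with its first two derivatives\<close>
  define r where "r = (\<lambda>b t. A * Q b t powr (- m))"
  define r1 where "r1 = (\<lambda>b t. - m * A * Q b t powr (- m - 1) * Q1 b t)"
  define r2 where "r2 = (\<lambda>b. A * (m * (m + 1) * q powr (- m - 2) * (2 * (x \<bullet> b))\<^sup>2 - 2 * m * q powr (- m - 1)))"
  have q: "q > 0" "(norm x)\<^sup>2 = q - a\<^sup>2"
    using a by (auto simp: q_def add_nonneg_pos)
  have Qpos: "Q b t > 0" and Qeq: "(norm (x + t *\<^sub>R b))\<^sup>2 + a\<^sup>2 = Q b t" if "b \<in> Basis" for b t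
  proof -
    show "(norm (x + t *\<^sub>R b))\<^sup>2 + a\<^sup>2 = Q b t"
      using that unfolding Q_def q_def power2_norm_eq_inner
      by (simp add: algebra_simps inner_commute inner_add_left inner_add_right power2_eq_square)
    moreover have "(norm (x + t *\<^sub>R b))\<^sup>2 + a\<^sup>2 > 0" using a by (simp add: add_nonneg_pos)
    ultimately show "Q b t > 0" by simp
  qed
  have Q0: "Q b 0 = q" "Q1 b 0 = 2 * (x \<bullet> b)" for b by (simp_all add: Q_def Q1_def)
  have dQ: "(Q b has_real_derivative Q1 b t) (at t)" for b t
    unfolding Q_def Q1_def by (auto intro!: derivative_eq_intros)
  have dQ1: "(Q1 b has_real_derivative 2) (at t)" for b t
    unfolding Q1_def by (auto intro!: derivative_eq_intros)
  have sphere: "range (c b) \<subseteq> unit_sphere" for b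
    unfolding c_def using stereo_sphere[OF a] by blast
  have PS: "P \<in> unit_sphere" unfolding P_def by (rule stereo_sphere[OF a])
  have c0: "c b 0 = P" for b by (simp add: c_def P_def)
  have PU: "P \<in> U" unfolding P_def using U by (rule eventually_nhds_x_imp_x)
  have diff: "v differentiable (at p within unit_sphere)" "g differentiable (at p within unit_sphere)"
    if "p \<in> U" for p
    using v that unfolding C2_on_sphere_def C1_on_sphere_def g_def by blast+
  have dY: "((\<lambda>t. Y + t *\<^sub>R (b, 0)) has_vector_derivative (b, 0)) (at t)" for b t
    by (auto intro!: derivative_eq_intros)
  have dc: "(c b has_vector_derivative c1 b t) (at t)" if b: "b \<in> Basis" for b t
  proof -
    have c: "c b = (\<lambda>t. (0, \<sigma>) + (2 * a / Q b t) *\<^sub>R (Y + t *\<^sub>R (b, 0)))"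
      unfolding c_def stereo_def Qeq[OF b] Y_def by auto
    have "((\<lambda>t. 2 * a / Q b t) has_real_derivative - (2 * a * Q1 b t / (Q b t)\<^sup>2)) (at t)"
      using Qpos[OF b, of t]
      by (auto intro!: derivative_eq_intros dQ simp: power2_eq_square)
    from has_vector_derivative_scaleR[OF this dY[of b t]]
    have "((\<lambda>t. (2 * a / Q b t) *\<^sub>R (Y + t *\<^sub>R (b, 0))) has_vector_derivative
      (2 * a / Q b t) *\<^sub>R (b, 0) + (- (2 * a * Q1 b t / (Q b t)\<^sup>2)) *\<^sub>R (Y + t *\<^sub>R (b, 0))) (at t)" .
    from has_vector_derivative_add[OF has_vector_derivative_const this]
    show ?thesis unfolding c c1_def
      by (rule has_vector_derivative_eq_rhs) (simp add: algebra_simps)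
  qed
  have dc1: "(c1 b has_vector_derivative c2 b) (at 0)" if b: "b \<in> Basis" for b
  proof -
    have 1: "((\<lambda>t. 2 * a / Q b t) has_real_derivative - (4 * a * (x \<bullet> b) / q\<^sup>2)) (at 0)"
      using q(1) by (auto intro!: derivative_eq_intros dQ simp: power2_eq_square Q0)
    have 2: "((\<lambda>t. 2 * a * Q1 b t / (Q b t)\<^sup>2) has_real_derivative
        (4 * a / q\<^sup>2 - 16 * a * (x \<bullet> b)\<^sup>2 / q^3)) (at 0)"
      using q(1) by (auto intro!: derivative_eq_intros dQ dQ1 simp: Q0)
         (simp add: field_simps power2_eq_square power3_eq_cube power4_eq_xxxx)
    show ?thesis unfolding c1_def c2_def
      by (rule has_vector_derivative_eq_rhs[OF has_vector_derivative_diff[OF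
            has_vector_derivative_scaleR[OF 1 has_vector_derivative_const]
            has_vector_derivative_scaleR[OF 2 dY]]])
         (simp add: Q0 algebra_simps, simp flip: scaleR_add_left)
  qed
  have dr: "(r b has_real_derivative r1 b t) (at t)" if b: "b \<in> Basis" for b t
    unfolding r_def r1_def using Qpos[OF b, of t]
    by (auto intro!: derivative_eq_intros dQ)
  have dr1: "(r1 b has_real_derivative r2 b) (at 0)" if b: "b \<in> Basis" for b
  proof -
    have e: "- m - 1 - 1 = - m - 2" by simp
    have "((\<lambda>t. Q b t powr (- m - 1)) has_real_derivative (- m - 1) * q powr (- m - 2) * (2 * (x \<bullet> b))) (at 0)"
      using q(1) by (auto intro!: derivative_eq_intros dQ simp: Q0 e)
    from DERIV_mult[OF DERIV_cmult[OF this, of "- m * A"] dQ1]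
    show ?thesis unfolding r1_def r2_def
      by (rule DERIV_cong) (simp add: Q0 algebra_simps power2_eq_square)
  qed
  have lap: "has_laplacian (\<lambda>y. A * ((norm y)\<^sup>2 + a\<^sup>2) powr (- m) * v (stereo a \<sigma> y))
     (\<Sum>b\<in>Basis. r2 b * v P + 2 * r1 b 0 * (g P \<bullet> c1 b 0) + r b 0 * (E (c1 b 0) \<bullet> c1 b 0 + g P \<bullet> c2 b)) x"
  proof (rule has_laplacianI[where G = "\<lambda>b t. r1 b t * v (c b t) + r b t * (g (c b t) \<bullet> c1 b t)", OF _ _ refl])
    fix b :: 'a assume b: "b \<in> Basis"
    have "((\<lambda>t. x + t *\<^sub>R b) \<longlongrightarrow> x + 0 *\<^sub>R b) (nhds 0)"
      by (intro tendsto_intros filterlim_ident)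
    hence ev: "\<forall>\<^sub>F t in nhds 0. c b t \<in> U"
      using eventually_compose_filterlim[OF U, of "\<lambda>t. x + t *\<^sub>R b" "nhds 0"] by (simp add: c_def)
    have dv: "((\<lambda>t. v (c b t)) has_real_derivative g (c b t) \<bullet> c1 b t) (at t)" if "c b t \<in> U" for t
    proof -
      have "c b t \<in> unit_sphere" using sphere[of b] by blast
      from sphere_grad_inner[OF this diff(1)[OF that]] that
        sphere_curve_has_vector_derivative[OF sphere dc[OF b] diff(1)[OF that]]
      show ?thesis unfolding has_real_derivative_iff_has_vector_derivative g_def by simp
    qed
    show "\<forall>\<^sub>F t in nhds 0. ((\<lambda>s. A * ((norm (x + s *\<^sub>R b))\<^sup>2 + a\<^sup>2) powr (- m) * v (stereo a \<sigma> (x + s *\<^sub>R b)))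
        has_real_derivative r1 b t * v (c b t) + r b t * (g (c b t) \<bullet> c1 b t)) (at t)"
      using ev
    proof eventually_elim
      case (elim t)
      show ?case using DERIV_mult[OF dr[OF b, of t] dv[OF elim]]
        unfolding Qeq[OF b] by (simp add: c_def r_def mult_ac add_ac)
    qed
    have cU: "c b 0 \<in> U" using PU c0 by simp
    have "((\<lambda>t. g (c b t)) has_vector_derivative E (c1 b 0)) (at 0)"
      using sphere_curve_has_vector_derivative[OF sphere dc[OF b] diff(2)[OF cU]] by (simp add: E_def c0)
    from bounded_bilinear.has_vector_derivative[OF bounded_bilinear_inner this dc1[OF b]]
    have "((\<lambda>t. g (c b t) \<bullet> c1 b t) has_real_derivative g P \<bullet> c2 b + E (c1 b 0) \<bullet> c1 b 0) (at 0)"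
      by (simp add: has_real_derivative_iff_has_vector_derivative c0)
    from DERIV_add[OF DERIV_mult[OF dr1[OF b] dv[OF cU]] DERIV_mult[OF dr[OF b, of 0] this]]
    show "((\<lambda>t. r1 b t * v (c b t) + r b t * (g (c b t) \<bullet> c1 b t)) has_real_derivative
       r2 b * v P + 2 * r1 b 0 * (g P \<bullet> c1 b 0) + r b 0 * (E (c1 b 0) \<bullet> c1 b 0 + g P \<bullet> c2 b)) (at 0)"
      by (rule DERIV_cong) (simp add: c0 algebra_simps)
  qed
  define \<rho> where "\<rho> = A * q powr (- m)"
  define s where "s = (norm x)\<^sup>2"
  define X where "X = (x, 0::real)"
  have m: "n = 2 * m + 2" by (simp add: m_def field_simps)
  have s: "s = q - a\<^sup>2" using q by (simp add: s_def)
  have sums: "(\<Sum>b\<in>Basis. (x \<bullet> b)\<^sup>2) = s"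
    unfolding s_def power2_norm_eq_inner euclidean_inner[of x x] by (simp add: power2_eq_square)
  have sumb: "(\<Sum>b\<in>Basis. (x \<bullet> b) *\<^sub>R (b, 0::real)) = X"
    by (simp add: X_def sum_prod euclidean_representation)
  have pq: "q powr (- m - 1) = q powr (- m) / q" "q powr (- m - 2) = q powr (- m) / q\<^sup>2"
    using q(1) by (simp_all add: powr_diff)
  \<comment> \<open>the terms without derivatives of \<open>v\<close>\<close>
  have S1: "(\<Sum>b\<in>Basis. r2 b) = \<rho> * (2 * a / q)\<^sup>2 * (- (n * (n - 2) / 4))"
  proof -
    have "(\<Sum>b\<in>Basis. r2 b) = A * (4 * m * (m + 1) * q powr (- m - 2) * s - 2 * m * n * q powr (- m - 1))"
      unfolding r2_def n_def sums[symmetric]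
      by (simp add: sum_subtractf power_mult_distrib flip: sum_distrib_left)
    also have "\<dots> = \<rho> * (2 * a / q)\<^sup>2 * (- (n * (n - 2) / 4))"
      unfolding pq \<rho>_def m s using q(1) by (simp add: field_simps power2_eq_square)
    finally show ?thesis .
  qed
  have c10: "c1 b 0 = (2 * a / q) *\<^sub>R (b, 0) - (4 * a * (x \<bullet> b) / q\<^sup>2) *\<^sub>R Y" for b
    by (simp add: c1_def Q0 flip: zero_prod_def)
  \<comment> \<open>the terms with second derivatives of \<open>v\<close>\<close>
  have S2: "(\<Sum>b\<in>Basis. E (c1 b 0) \<bullet> c1 b 0) = (2 * a / q)\<^sup>2 * sphere_laplacian v P"
    unfolding E_def sphere_laplacian_def g_def[symmetric]
    by (rule sphere_div_conformal_frame[OF PS diff(2)[OF PU]])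
       (simp only: c10 Y_def P_def q_def stereo_frame[OF a])
  \<comment> \<open>the vector paired with the gradient of \<open>v\<close> is normal to the sphere\<close>
  have S3: "(\<Sum>b\<in>Basis. (2 * r1 b 0) *\<^sub>R c1 b 0 + r b 0 *\<^sub>R c2 b) = (- (4 * a\<^sup>2 * n * \<rho> / q\<^sup>2)) *\<^sub>R P"
  proof -
    have t: "(2 * r1 b 0) *\<^sub>R c1 b 0 + r b 0 *\<^sub>R c2 b =
       (- (8 * a * \<rho> * (m + 1) / q\<^sup>2)) *\<^sub>R ((x \<bullet> b) *\<^sub>R (b, 0)) +
       ((16 * a * \<rho> * (m + 1) / q ^ 3) * (x \<bullet> b)\<^sup>2 - 4 * a * \<rho> / q\<^sup>2) *\<^sub>R Y" for b
    proof -
      have r1: "r1 b 0 = - 2 * m * \<rho> * (x \<bullet> b) / q" by (simp add: r1_def Q0 pq \<rho>_def)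
      have r0: "r b 0 = \<rho>" by (simp add: r_def Q0 \<rho>_def)
      have f1: "2 * (- 2 * m * \<rho> * (x \<bullet> b) / q) * (2 * a / q) + \<rho> * (- 8 * a * (x \<bullet> b) / q\<^sup>2)
         = - (8 * a * \<rho> * (m + 1) / q\<^sup>2) * (x \<bullet> b)"
        using q(1) by (simp add: field_simps power2_eq_square)
      have f2: "- (2 * (- 2 * m * \<rho> * (x \<bullet> b) / q) * (4 * a * (x \<bullet> b) / q\<^sup>2)) + \<rho> * (- 4 * a / q\<^sup>2 + 16 * a * (x \<bullet> b)\<^sup>2 / q^3)
         = (16 * a * \<rho> * (m + 1) / q ^ 3) * (x \<bullet> b)\<^sup>2 - 4 * a * \<rho> / q\<^sup>2"
        using q(1) by (simp add: field_simps power2_eq_square power3_eq_cube)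
      have "(2 * r1 b 0) *\<^sub>R c1 b 0 + r b 0 *\<^sub>R c2 b =
        (2 * (- 2 * m * \<rho> * (x \<bullet> b) / q) * (2 * a / q) + \<rho> * (- 8 * a * (x \<bullet> b) / q\<^sup>2)) *\<^sub>R (b, 0) +
        (- (2 * (- 2 * m * \<rho> * (x \<bullet> b) / q) * (4 * a * (x \<bullet> b) / q\<^sup>2)) + \<rho> * (- 4 * a / q\<^sup>2 + 16 * a * (x \<bullet> b)\<^sup>2 / q^3)) *\<^sub>R Y"
        unfolding r1 r0 c10 c2_def
        by (simp only: scaleR_add_left scaleR_minus_left scaleR_diff_right scaleR_add_right scaleR_scaleR)
           (simp add: algebra_simps)
      thus ?thesis unfolding f1 f2 by simp
    qed
    have "(\<Sum>b\<in>Basis. (2 * r1 b 0) *\<^sub>R c1 b 0 + r b 0 *\<^sub>R c2 b) =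
       (- (8 * a * \<rho> * (m + 1) / q\<^sup>2)) *\<^sub>R X +
       ((16 * a * \<rho> * (m + 1) / q ^ 3) * s - n * (4 * a * \<rho> / q\<^sup>2)) *\<^sub>R Y"
    proof -
      have "(\<Sum>b\<in>(Basis::'a set). (16 * a * \<rho> * (m + 1) / q ^ 3) * (x \<bullet> b)\<^sup>2 - 4 * a * \<rho> / q\<^sup>2) =
         (16 * a * \<rho> * (m + 1) / q ^ 3) * s - n * (4 * a * \<rho> / q\<^sup>2)"
        by (simp only: sum_subtractf sum_distrib_left[symmetric] sums) (simp add: n_def)
      thus ?thesis unfolding t
        by (simp only: sum.distrib scaleR_sum_right[symmetric] scaleR_sum_left[symmetric] sumb)
    qed
    also have "(16 * a * \<rho> * (m + 1) / q ^ 3) * s - n * (4 * a * \<rho> / q\<^sup>2) =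
       - (4 * a * n * \<rho> / q\<^sup>2) * (2 * a\<^sup>2 / q - 1)"
      unfolding m s using q(1) by (simp add: field_simps power2_eq_square power3_eq_cube)
    also have "- (8 * a * \<rho> * (m + 1) / q\<^sup>2) = - (4 * a * n * \<rho> / q\<^sup>2)" by (simp add: m)
    also have "(- (4 * a * n * \<rho> / q\<^sup>2)) *\<^sub>R X + (- (4 * a * n * \<rho> / q\<^sup>2) * (2 * a\<^sup>2 / q - 1)) *\<^sub>R Y =
       (- (4 * a * n * \<rho> / q\<^sup>2)) *\<^sub>R (X + (2 * a\<^sup>2 / q - 1) *\<^sub>R Y)"
      by (simp only: scaleR_add_right scaleR_scaleR)
    also have "X + (2 * a\<^sup>2 / q - 1) *\<^sub>R Y = a *\<^sub>R P"
      unfolding P_def stereo_def q_def[symmetric] X_def Y_def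
      by (simp add: algebra_simps power2_eq_square)
    finally show ?thesis by (simp add: power2_eq_square mult_ac)
  qed
  have "(\<Sum>b\<in>Basis. r2 b * v P + 2 * r1 b 0 * (g P \<bullet> c1 b 0) + r b 0 * (E (c1 b 0) \<bullet> c1 b 0 + g P \<bullet> c2 b))
     = (\<Sum>b\<in>Basis. r2 b) * v P + g P \<bullet> (\<Sum>b\<in>Basis. (2 * r1 b 0) *\<^sub>R c1 b 0 + r b 0 *\<^sub>R c2 b)
       + \<rho> * (\<Sum>b\<in>Basis. E (c1 b 0) \<bullet> c1 b 0)"
    by (simp add: inner_sum_right inner_add_right sum_distrib_left sum_distrib_right sum.distrib
        r_def Q0 \<rho>_def algebra_simps)
  also have "g P \<bullet> (\<Sum>b\<in>Basis. (2 * r1 b 0) *\<^sub>R c1 b 0 + r b 0 *\<^sub>R c2 b) = 0"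
    unfolding S3 using sphere_grad_inner[OF PS diff(1)[OF PU], of P] sphere_deriv_normal[OF PS diff(1)[OF PU]]
    by (simp add: g_def)
  finally have L: "(\<Sum>b\<in>Basis. r2 b * v P + 2 * r1 b 0 * (g P \<bullet> c1 b 0) + r b 0 * (E (c1 b 0) \<bullet> c1 b 0 + g P \<bullet> c2 b))
     = \<rho> * (2 * a / q)\<^sup>2 * (sphere_laplacian v P - n * (n - 2) / 4 * v P)"
    unfolding S1 S2 by (simp add: algebra_simps)
  have mu: "\<mu> y powr m = A * ((norm y)\<^sup>2 + a\<^sup>2) powr (- m)" for y
    using a unfolding \<mu>_def A_def
    by (subst powr_divide) (auto simp: powr_minus divide_inverse)
  have "\<mu> x powr ((n + 2) / 2) = \<mu> x powr (m + 2)" by (simp add: m_def field_simps)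
  also have "\<dots> = \<rho> * (2 * a / q)\<^sup>2"
    using a q(1) mu[of x] by (simp add: powr_add \<rho>_def q_def \<mu>_def)
  finally have "\<mu> x powr ((n + 2) / 2) = \<rho> * (2 * a / q)\<^sup>2" .
  thus ?thesis using lap unfolding L mu m_def[symmetric] by (simp add: P_def)
qed

section \<open>From the sphere to Euclidean space\<close>

lemma stereo_north_unit: "stereo 1 1 (x::real^'n) \<in> unit_sphere - {north}"
proof -
  have "(norm x)\<^sup>2 + 1 > 0" by (simp add: add_nonneg_pos)
  thus ?thesis using stereo_sphere[of 1 1 x] by (auto simp: stereo_def north_def)
qed

lemma stereo_inversion:
  assumes "r > 0" "x \<noteq> 0"
  shows "stereo (r\<^sup>2) (-1) x = stereo 1 1 (inversion r x)"
proof -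
  define s where "s = (norm x)\<^sup>2"
  have s: "s > 0" using assms by (simp add: s_def)
  have "norm (inversion r x) = r\<^sup>2 / norm x" using assms by (simp add: norm_inversion)
  hence n: "(norm (inversion r x))\<^sup>2 = r ^ 4 / s"
    by (simp add: s_def power_divide flip: power_mult)
  have i: "inversion r x = (r\<^sup>2 / s) *\<^sub>R x" by (simp add: inversion_def power_divide s_def)
  have r: "(r\<^sup>2)\<^sup>2 = r ^ 4" by (simp flip: power_mult)
  have pos: "r ^ 4 > 0" "r ^ 4 + s > 0" using assms(1) s by (simp_all add: add_pos_pos)
  have "2 * r\<^sup>2 / (s + r ^ 4) = 2 / (r ^ 4 / s + 1) * (r\<^sup>2 / s)"
    using s pos by (simp add: field_simps)
  moreover have "- 1 + 2 * r ^ 4 / (s + r ^ 4) = 1 - 2 / (r ^ 4 / s + 1)"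
    using s pos by (simp add: field_simps)
  moreover have "2 * r\<^sup>2 / (s + r ^ 4) * r\<^sup>2 = 2 * r ^ 4 / (s + r ^ 4)"
    by (simp add: power2_eq_square power4_eq_xxxx)
  moreover have "stereo 1 1 (inversion r x) = (0, 1) + (2 / (r ^ 4 / s + 1)) *\<^sub>R ((r\<^sup>2 / s) *\<^sub>R x, - 1)"
    unfolding stereo_def n by (simp add: i)
  moreover have "stereo (r\<^sup>2) (-1) x = (0, - 1) + (2 * r\<^sup>2 / (s + r ^ 4)) *\<^sub>R (x, r\<^sup>2)"
    unfolding stereo_def r s_def by simp
  ultimately show ?thesis by simp
qed

lemma stereo_surj:
  assumes "p \<in> unit_sphere - {north :: (real^'n) \<times> real}"
  obtains x where "p = stereo 1 1 x"
proof -
  obtain \<xi> s where p: "p = (\<xi>, s)" by (cases p)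
  have "p \<bullet> p = 1" using assms by (simp add: norm_eq_1)
  hence n: "(norm \<xi>)\<^sup>2 = 1 - s\<^sup>2" by (simp add: p inner_prod_def dot_square_norm power2_eq_square)
  have "s \<noteq> 1"
  proof
    assume "s = 1"
    hence "\<xi> = 0" using n by simp
    thus False using assms \<open>s = 1\<close> p by (simp add: north_def)
  qed
  moreover have "s\<^sup>2 \<le> 1" using n by (metis diff_ge_0_iff_ge zero_le_power2)
  ultimately have s: "s < 1" using abs_square_le_1[of s] by linarith
  define x where "x = (1 / (1 - s)) *\<^sub>R \<xi>"
  have "(norm x)\<^sup>2 = (1 - s\<^sup>2) / (1 - s)\<^sup>2" by (simp add: x_def power_divide n)
  also have "1 - s\<^sup>2 = (1 + s) * (1 - s)" by (simp add: algebra_simps power2_eq_square)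
  also have "(1 + s) * (1 - s) / (1 - s)\<^sup>2 = (1 + s) / (1 - s)" using s by (simp add: power2_eq_square)
  also have "\<dots> = 2 / (1 - s) - 1" using s by (simp add: field_simps)
  finally have "(norm x)\<^sup>2 + 1\<^sup>2 = 2 / (1 - s)" by simp
  hence "stereo 1 1 x = (0, 1) + (1 - s) *\<^sub>R (x, - 1)" using s by (simp add: stereo_def) (simp add: field_simps)
  also have "\<dots> = p" using s by (simp add: x_def p)
  finally show ?thesis by (intro that[of x]) simp
qed

lemma norm_stereo_north:
  "norm (stereo 1 1 (x::real^'n) - north) = 2 / sqrt ((norm x)\<^sup>2 + 1)"
proof -
  have q: "(norm x)\<^sup>2 + 1 > 0" by (simp add: add_nonneg_pos)
  have "stereo 1 1 x - north = (2 / ((norm x)\<^sup>2 + 1)) *\<^sub>R (x, - 1)"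
    by (simp add: stereo_def north_def)
  hence "norm (stereo 1 1 x - north) = \<bar>2 / ((norm x)\<^sup>2 + 1)\<bar> * norm (x, - 1 :: real)"
    by (simp only: norm_scaleR)
  also have "norm (x, - 1 :: real) = sqrt ((norm x)\<^sup>2 + 1)" by (simp add: norm_Pair)
  also have "\<bar>2 / ((norm x)\<^sup>2 + 1)\<bar> * sqrt ((norm x)\<^sup>2 + 1) = 2 / sqrt ((norm x)\<^sup>2 + 1)"
    using q real_div_sqrt[of "(norm x)\<^sup>2 + 1"] by (simp add: field_simps)
  finally show ?thesis .
qed

text \<open>The weight \<open>(2 a / q) powr ((n + 2) / 2)\<close> produced by the Laplacian is exactly the one that turns the power
of \<open>v\<close> into the same power of \<open>W\<close>; this is where the critical exponent enters.\<close>

lemma stereo_pullback_equation: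
  fixes K v :: "(real^'n) \<times> real \<Rightarrow> real" and x :: "real^'n"
  assumes dim: "CARD('n) \<ge> 3"
    and a: "a > 0" "\<sigma>\<^sup>2 = 1"
    and v: "C2_on_sphere (unit_sphere - {north}) v" "solves_on_punctured_sphere K v"
    and U: "\<forall>\<^sub>F y in nhds x. stereo a \<sigma> y \<in> unit_sphere - {north}"
  defines "n \<equiv> real CARD('n)"
  defines "W \<equiv> \<lambda>y::real^'n. (2 * a / ((norm y)\<^sup>2 + a\<^sup>2)) powr ((n - 2) / 2) * v (stereo a \<sigma> y)"
  shows "has_laplacian W (- K (stereo a \<sigma> x) * W x powr ((n + 2) / (n - 2))) x"
proof -
  define P where "P = stereo a \<sigma> x"
  define \<mu> where "\<mu> = 2 * a / ((norm x)\<^sup>2 + a\<^sup>2)"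
  have \<mu>: "\<mu> > 0" using a by (simp add: \<mu>_def add_nonneg_pos)
  have "P \<in> unit_sphere - {north}" unfolding P_def using U by (rule eventually_nhds_x_imp_x)
  hence "v P > 0 \<and> - conf_laplacian v P = K P * v P powr ((n + 2) / (n - 2))"
    using v(2) unfolding solves_on_punctured_sphere_def n_def by blast
  hence eq: "v P > 0" "sphere_laplacian v P - n * (n - 2) / 4 * v P = - K P * v P powr ((n + 2) / (n - 2))"
    by (auto simp: conf_laplacian_def n_def)
  have e: "(n - 2) / 2 * ((n + 2) / (n - 2)) = (n + 2) / 2"
  proof -
    have *: "d / 2 * (e / d) = e / 2" if "d \<noteq> 0" for d e :: real using that by simp
    show ?thesis by (rule *) (use dim in \<open>simp add: n_def\<close>)
  qed
  have "W x powr ((n + 2) / (n - 2)) = \<mu> powr ((n + 2) / 2) * v P powr ((n + 2) / (n - 2))"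
    unfolding W_def \<mu>_def[symmetric] P_def[symmetric] using \<mu> eq(1)
    by (simp only: powr_mult powr_powr e)
  hence "\<mu> powr ((n + 2) / 2) * (sphere_laplacian v P - n * (n - 2) / 4 * v P)
      = - K P * W x powr ((n + 2) / (n - 2))"
    unfolding eq(2) by simp
  with has_laplacian_stereo_pullback[OF a v(1) U] show ?thesis
    by (simp add: W_def n_def P_def \<mu>_def)
qed

text \<open>Rays correspond to meridians, so that monotonicity along the meridian field becomes monotonicity in
\<open>|x|\<close>.\<close>

lemma stereo_ray_derivative:
  fixes x :: "real^'n"
  assumes x: "x \<noteq> 0" and t: "t > 0"
  defines "q \<equiv> (norm (t *\<^sub>R x))\<^sup>2 + 1"
  shows "((\<lambda>t. stereo 1 1 (t *\<^sub>R x)) has_vector_derivative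
     (4 * t * (norm x)\<^sup>2 / q\<^sup>2) *\<^sub>R meridian_field (stereo 1 1 (t *\<^sub>R x))) (at t)"
proof -
  define s where "s = (norm x)\<^sup>2"
  have s: "s > 0" using x by (simp add: s_def)
  have q: "q = t\<^sup>2 * s + 1" by (simp add: q_def s_def power_mult_distrib)
  have qpos: "q > 0" "t\<^sup>2 * s > 0" using s t by (auto simp: q add_pos_pos)
  have c: "(\<lambda>t. stereo 1 1 (t *\<^sub>R x)) =
      (\<lambda>t. (0, 1) + (2 / (t\<^sup>2 * s + 1)) *\<^sub>R (t *\<^sub>R (x, 0) + (0, - 1)))"
    by (auto simp: stereo_def s_def power_mult_distrib)
  have 1: "((\<lambda>t. 2 / (t\<^sup>2 * s + 1)) has_real_derivative - (4 * t * s / q\<^sup>2)) (at t)"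
    using qpos by (auto intro!: derivative_eq_intros simp: q power2_eq_square)
  have 2: "((\<lambda>t. t *\<^sub>R (x, 0) + (0, - 1)) has_vector_derivative (x, 0::real)) (at t)"
    by (auto intro!: derivative_eq_intros)
  have d: "((\<lambda>t. stereo 1 1 (t *\<^sub>R x)) has_vector_derivative
     0 + ((2 / (t\<^sup>2 * s + 1)) *\<^sub>R (x, 0) + (- (4 * t * s / q\<^sup>2)) *\<^sub>R (t *\<^sub>R (x, 0) + (0, - 1)))) (at t)"
    unfolding c by (intro has_vector_derivative_add has_vector_derivative_const has_vector_derivative_scaleR 1 2)
  define P where "P = stereo 1 1 (t *\<^sub>R x)"
  have P: "P = ((2 * t / q) *\<^sub>R x, 1 - 2 / q)"
    by (simp add: P_def stereo_def q_def)
  have z: "1 - (1 - 2 / q)\<^sup>2 = 4 * t\<^sup>2 * s / q\<^sup>2"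
    using qpos by (simp add: field_simps power2_eq_square) (simp add: q field_simps power2_eq_square)
  have tp: "tproj P north = (- ((1 - 2 / q) * (2 * t / q)) *\<^sub>R x, 1 - (1 - 2 / q)\<^sup>2)"
    by (simp add: tproj_def P north_def power2_eq_square)
  have e: "4 * t * s / q\<^sup>2 * (1 / (4 * t\<^sup>2 * s / q\<^sup>2)) = 1 / t"
    using s t qpos(1) by (simp add: field_simps power2_eq_square)
  have f1: "2 / q - 4 * t\<^sup>2 * s / q\<^sup>2 = - ((1 - 2 / q) * (2 / q))"
    using qpos(1) by (simp add: field_simps power2_eq_square) (simp add: q field_simps power2_eq_square)
  have "(4 * t * s / q\<^sup>2) *\<^sub>R meridian_field P = (1 / t) *\<^sub>R tproj P north"
    unfolding meridian_field_def by (simp only: P snd_conv z scaleR_scaleR e)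
  also have "\<dots> = ((- ((1 - 2 / q) * (2 / q))) *\<^sub>R x, 4 * t * s / q\<^sup>2)"
    unfolding tp z using t by (simp add: power2_eq_square)
  also have "\<dots> = 0 + ((2 / (t\<^sup>2 * s + 1)) *\<^sub>R (x, 0) + (- (4 * t * s / q\<^sup>2)) *\<^sub>R (t *\<^sub>R (x, 0) + (0, - 1)))"
    unfolding f1[symmetric] q[symmetric] by (simp add: algebra_simps power2_eq_square)
  finally show ?thesis using d by (simp add: s_def P_def)
qed

lemma C1_on_sphere_continuous:
  assumes "C1_on_sphere U f" "U \<subseteq> unit_sphere"
  shows "continuous_on U f"
proof -
  have "continuous (at p within U) f" if "p \<in> U" for p
    using assms that differentiable_imp_continuous_within continuous_within_subset
    unfolding C1_on_sphere_def by blast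
  thus ?thesis by (simp add: continuous_on_eq_continuous_within)
qed

text \<open>A curve is at least as long as its chord. The great circle arc serves only to show that
the infimum is taken over a nonempty set.\<close>

lemma chord_le_sphere_dist:
  fixes p :: "(real^'n) \<times> real"
  assumes p: "p \<in> unit_sphere"
  shows "norm (p - north) \<le> sphere_dist p north"
  unfolding sphere_dist_def
proof (rule cInf_greatest)
  obtain \<xi> s where ps: "p = (\<xi>, s)" by (cases p)
  have "p \<bullet> p = 1" using p by (simp add: norm_eq_1)
  hence n: "(norm \<xi>)\<^sup>2 = 1 - s\<^sup>2" by (simp add: ps inner_prod_def dot_square_norm power2_eq_square)
  hence s: "s\<^sup>2 \<le> 1" by (metis diff_ge_0_iff_ge zero_le_power2)
  hence s1: "-1 \<le> s" "s \<le> 1" using abs_square_le_1 by (auto simp: abs_le_iff)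
  define \<alpha> where "\<alpha> = arccos s"
  have "norm \<xi> = sqrt (1 - s\<^sup>2)" using n by (metis norm_ge_zero real_sqrt_unique)
  hence \<alpha>: "cos \<alpha> = s" "sin \<alpha> = norm \<xi>" using s1 by (simp_all add: \<alpha>_def sin_arccos)
  obtain \<omega> :: "real^'n" where w: "norm \<omega> = 1" "norm \<xi> *\<^sub>R \<omega> = \<xi>"
  proof (cases "\<xi> = 0")
    case True
    obtain \<omega> :: "real^'n" where "norm \<omega> = 1" using vector_choose_size[of 1] by auto
    thus ?thesis using that True by simp
  next
    case False
    thus ?thesis using that[of "(1 / norm \<xi>) *\<^sub>R \<xi>"] by simp
  qed
  define \<gamma> where "\<gamma> = (\<lambda>t. (sin (\<alpha> * (1 - t)) *\<^sub>R \<omega>, cos (\<alpha> * (1 - t))))"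
  define D where "D = (\<lambda>t. ((- \<alpha> * cos (\<alpha> * (1 - t))) *\<^sub>R \<omega>, \<alpha> * sin (\<alpha> * (1 - t))))"
  have "(\<gamma> has_vector_derivative D t) (at t)" for t
    unfolding \<gamma>_def D_def
    by (intro has_vector_derivative_Pair)
       (auto intro!: derivative_eq_intros simp: has_real_derivative_iff_has_vector_derivative[symmetric])
  moreover have "continuous_on {0..1} D" unfolding D_def by (intro continuous_intros)
  ultimately have "\<gamma> C1_differentiable_on {0..1}" unfolding C1_differentiable_on_def by blast
  moreover have "path_image \<gamma> \<subseteq> unit_sphere"
    using w(1) by (auto simp: path_image_def \<gamma>_def norm_Pair)
  moreover have "pathstart \<gamma> = p" "pathfinish \<gamma> = north"
    using \<alpha> w ps by (simp_all add: pathstart_def pathfinish_def \<gamma>_def north_def)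
  ultimately show "{integral {0..1} (\<lambda>t. norm (vector_derivative \<gamma> (at t))) |\<gamma>.
     \<gamma> C1_differentiable_on {0..1} \<and> path_image \<gamma> \<subseteq> unit_sphere \<and>
     pathstart \<gamma> = p \<and> pathfinish \<gamma> = north} \<noteq> {}" by blast
next
  fix l assume "l \<in> {integral {0..1} (\<lambda>t. norm (vector_derivative \<gamma> (at t))) |\<gamma>.
     \<gamma> C1_differentiable_on {0..1} \<and> path_image \<gamma> \<subseteq> unit_sphere \<and>
     pathstart \<gamma> = p \<and> pathfinish \<gamma> = north}"
  then obtain \<gamma> where \<gamma>: "l = integral {0..1} (\<lambda>t. norm (vector_derivative \<gamma> (at t)))"
    "\<gamma> C1_differentiable_on {0..1}" "\<gamma> 0 = p" "\<gamma> 1 = north"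
    by (auto simp: pathstart_def pathfinish_def)
  then obtain D where D: "\<And>t. t \<in> {0..1} \<Longrightarrow> (\<gamma> has_vector_derivative D t) (at t)"
    "continuous_on {0..1} D" unfolding C1_differentiable_on_def by blast
  have l: "l = integral {0..1} (\<lambda>t. norm (D t))"
    unfolding \<gamma>(1) by (rule integral_cong) (use D(1) vector_derivative_at in fastforce)
  have int: "(D has_integral (\<gamma> 1 - \<gamma> 0)) {0..1}"
    by (rule fundamental_theorem_of_calculus) (auto intro!: has_vector_derivative_at_within D(1))
  have "norm (integral {0..1} D) \<le> integral {0..1} (\<lambda>t. norm (D t))"
    by (rule integral_norm_bound_integral)
       (use D(2) in \<open>auto intro!: integrable_continuous_real continuous_intros\<close>)
  thus "norm (p - north) \<le> l"
    using int \<gamma>(3,4) l by (simp add: integral_unique norm_minus_commute)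
qed

section \<open>The lower bound near the pole\<close>

text \<open>The pull-back \<open>u\<close> of \<open>v\<close> satisfies the assumptions of the moving sphere argument. If some inversion
preserved \<open>k\<close> outside its sphere, then by monotonicity \<open>k\<close> would be constant on
each ray, and the derivative of \<open>K\<close> along the meridians would vanish. Hence
\<open>u x \<ge> c |x| powr (- (n - 2) / 2)\<close> for large \<open>x\<close>; since \<open>|p - north| = 2 / sqrt (|x|\<^sup>2 + 1)\<close>, this becomes the claim
after division by the conformal factor.\<close>

lemma blow_up_in_chordal_distance:
  fixes K v :: "(real^'n) \<times> real \<Rightarrow> real"
  assumes dim: "CARD('n) \<ge> 3"
    and K_C1: "C1_on_sphere unit_sphere K"
    and K_mono: "\<forall>p\<in>unit_sphere - {north, south}. sphere_deriv K p (meridian_field p) \<ge> 0"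
    and K_nontrivial: "\<exists>p\<in>unit_sphere - {north, south}. sphere_deriv K p (meridian_field p) \<noteq> 0"
    and v: "C2_on_sphere (unit_sphere - {north}) v" "solves_on_punctured_sphere K v"
  shows "\<exists>c>0. \<forall>p\<in>unit_sphere - {north}. v p \<ge> c * norm (p - north) powr (- ((real CARD('n) - 2) / 2))"
proof -
  define n where "n = real CARD('n)"
  define m where "m = (n - 2) / 2"
  define u where "u = (\<lambda>x::real^'n. (2 / ((norm x)\<^sup>2 + 1)) powr m * v (stereo 1 1 x))"
  define k where "k = (\<lambda>x::real^'n. K (stereo 1 1 x))"
  have m: "m > 0" using dim by (simp add: m_def n_def)
  have qpos: "(norm x)\<^sup>2 + 1 > 0" for x :: "real^'n" by (simp add: add_nonneg_pos)
  have q0: "(norm x)\<^sup>2 + 1 \<noteq> 0" for x :: "real^'n" using qpos[of x] by linarith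
  have contv: "continuous_on (unit_sphere - {north}) v"
    using v(1) by (intro C1_on_sphere_continuous) (auto simp: C2_on_sphere_def)
  have contu: "continuous_on UNIV u"
    unfolding u_def
  proof (intro continuous_intros)
    show "continuous_on UNIV (\<lambda>x::real^'n. v (stereo 1 1 x))"
    proof (rule continuous_on_compose2[OF contv stereo_cont])
      show "range (stereo 1 1 :: real^'n \<Rightarrow> _) \<subseteq> unit_sphere - {north}"
        by (rule image_subsetI) (rule stereo_north_unit)
    qed simp
  qed (use q0 in auto)
  have upos: "u x > 0" for x
    using v(2) stereo_north_unit[of x] qpos[of x]
    by (simp add: u_def solves_on_punctured_sphere_def)
  have "bounded (K ` unit_sphere)"
    by (intro compact_imp_bounded compact_continuous_image C1_on_sphere_continuous[OF K_C1]) auto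
  then obtain B where B: "\<And>p. p \<in> unit_sphere \<Longrightarrow> \<bar>K p\<bar> \<le> B"
    by (fastforce simp: bounded_iff)
  define k0 where "k0 = max B 1"
  have dray: "((\<lambda>t. k (t *\<^sub>R x)) has_real_derivative
      (4 * t * (norm x)\<^sup>2 / ((norm (t *\<^sub>R x))\<^sup>2 + 1)\<^sup>2) *
        sphere_deriv K (stereo 1 1 (t *\<^sub>R x)) (meridian_field (stereo 1 1 (t *\<^sub>R x)))) (at t)"
    if "x \<noteq> 0" "t > 0" for x t
  proof -
    have S: "range (\<lambda>t. stereo 1 1 (t *\<^sub>R x)) \<subseteq> unit_sphere" using stereo_north_unit by blast
    have df: "K differentiable (at p within unit_sphere)" if "p \<in> unit_sphere" for p
      using K_C1 that by (auto simp: C1_on_sphere_def)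
    have P: "stereo 1 1 (t *\<^sub>R x) \<in> unit_sphere" using stereo_north_unit by blast
    from sphere_curve_has_vector_derivative[OF S stereo_ray_derivative[OF that] df[OF P]]
    show ?thesis unfolding k_def has_real_derivative_iff_has_vector_derivative
      by (simp add: linear_cmul[OF linear_sphere_deriv[OF P df[OF P]]])
  qed
  have nopole: "stereo 1 1 x \<in> unit_sphere - {north, south}" if "x \<noteq> 0" for x :: "real^'n"
    using stereo_north_unit[of x] that qpos[of x] by (auto simp: stereo_def south_def)
  have k_ray: "k (a *\<^sub>R x) \<le> k (b *\<^sub>R x)" if "x \<noteq> 0" "0 < a" "a \<le> b" for a b x
  proof (rule DERIV_nonneg_imp_nondecreasing[OF that(3)])
    fix t assume t: "a \<le> t" "t \<le> b"
    hence t0: "t > 0" using that by simp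
    have "stereo 1 1 (t *\<^sub>R x) \<in> unit_sphere - {north, south}"
      using that t by (intro nopole) auto
    hence nn: "0 \<le> sphere_deriv K (stereo 1 1 (t *\<^sub>R x)) (meridian_field (stereo 1 1 (t *\<^sub>R x)))"
      using K_mono by blast
    show "\<exists>y. ((\<lambda>t. k (t *\<^sub>R x)) has_real_derivative y) (at t) \<and> 0 \<le> y"
      by (rule exI, rule conjI, rule dray[OF that(1) t0]) (use nn t0 in simp)
  qed
  have inv_scale: "inversion r (t *\<^sub>R x) = (r\<^sup>2 / (t * (norm x)\<^sup>2)) *\<^sub>R x"
    if "t > 0" for r t and x :: "real^'n"
    using that by (simp add: inversion_def power_divide power_mult_distrib power2_eq_square)
  have nonconst: "\<exists>x. norm x > r \<and> k (inversion r x) \<noteq> k x" if r: "r > 0" for r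
  proof (rule ccontr)
    assume "\<not> ?thesis"
    hence sym: "\<And>x. norm x > r \<Longrightarrow> k (inversion r x) = k x" by auto
    obtain p where p: "p \<in> unit_sphere - {north, south}" "sphere_deriv K p (meridian_field p) \<noteq> 0"
      using K_nontrivial by blast
    then obtain x where x: "p = stereo 1 1 x" using stereo_surj[of p] by auto
    have x0: "x \<noteq> 0" using p(1) x by (auto simp: stereo_def south_def)
    \<comment> \<open>so large that \<open>T x\<close> lies outside the sphere of inversion and its mirror image
      is \<open>l x\<close> with \<open>l < 1\<close>\<close>
    define T where "T = max 2 (max (2 * r / norm x) (2 * (r / norm x)\<^sup>2))"
    have T: "T \<ge> 2" "T \<ge> 2 * r / norm x" "T \<ge> 2 * (r / norm x)\<^sup>2" by (auto simp: T_def)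
    have "r / norm x > 0" using r x0 by simp
    hence "r / norm x < T" using T(2) by simp
    hence "r < norm (T *\<^sub>R x)" using T(1) x0 by (simp add: divide_less_eq)
    from sym[OF this] have e: "k ((r\<^sup>2 / (T * (norm x)\<^sup>2)) *\<^sub>R x) = k (T *\<^sub>R x)"
      using inv_scale[of T r x] T(1) by simp
    define l where "l = r\<^sup>2 / (T * (norm x)\<^sup>2)"
    have "r\<^sup>2 / (norm x)\<^sup>2 \<le> T / 2" using T(3) by (simp add: power_divide mult.commute)
    hence "r\<^sup>2 / (norm x)\<^sup>2 / T \<le> T / 2 / T" using T(1) by (intro divide_right_mono) auto
    also have "T / 2 / T = 1 / 2" using T(1) by simp
    finally have "r\<^sup>2 / (norm x)\<^sup>2 / T \<le> 1 / 2" .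
    moreover have "l = r\<^sup>2 / (norm x)\<^sup>2 / T" by (simp add: l_def mult.commute)
    ultimately have "l < 1" by linarith
    moreover have "l > 0" using r x0 T(1) by (simp add: l_def)
    ultimately have l: "l < 1" "l > 0" by auto
    have const: "k (t *\<^sub>R x) = k (T *\<^sub>R x)" if "l < t" "t < T" for t
      using k_ray[OF x0 l(2), of t] k_ray[OF x0, of t T] that l e by (simp add: l_def)
    have "\<forall>\<^sub>F t in nhds (1::real). t \<in> {l<..<T}"
      using l T by (intro eventually_nhds_in_open) auto
    hence ev: "\<forall>\<^sub>F t in nhds (1::real). k (t *\<^sub>R x) = k (T *\<^sub>R x)"
      by eventually_elim (use const in auto)
    have "((\<lambda>t. k (t *\<^sub>R x)) has_real_derivative 0) (at 1)"
      using DERIV_cong_ev[OF refl ev refl] by simp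
    from DERIV_unique[OF this dray[OF x0, of 1]] show False
      using p(2) x0 qpos[of x] by (simp add: x)
  qed
  have kel: "kelvin u r y = (2 * r\<^sup>2 / ((norm y)\<^sup>2 + (r\<^sup>2)\<^sup>2)) powr m * v (stereo (r\<^sup>2) (- 1) y)"
    if r: "r > 0" and y: "y \<noteq> 0" for r y
  proof -
    define s where "s = (norm y)\<^sup>2"
    have s: "s > 0" using y by (simp add: s_def)
    have "(r / norm y) ^ (CARD('n) - 2) = ((r / norm y)\<^sup>2) powr m"
    proof -
      have "(norm y / r)\<^sup>2 powr (- m) = ((r / norm y)\<^sup>2) powr m"
        using r y by (simp add: powr_minus power_divide powr_divide)
      thus ?thesis
        using inverse_power_eq_powr[of "norm y / r" "CARD('n) - 2"] r y dim
        by (simp add: m_def n_def of_nat_diff)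
    qed
    also have "((r / norm y)\<^sup>2) powr m * (2 / ((norm (inversion r y))\<^sup>2 + 1)) powr m
       = ((r / norm y)\<^sup>2 * (2 / ((norm (inversion r y))\<^sup>2 + 1))) powr m"
      using qpos[of "inversion r y"] by (subst powr_mult) auto
    also have "(r / norm y)\<^sup>2 * (2 / ((norm (inversion r y))\<^sup>2 + 1)) = 2 * r\<^sup>2 / ((norm y)\<^sup>2 + (r\<^sup>2)\<^sup>2)"
    proof -
      have "s + (r\<^sup>2)\<^sup>2 > 0" using s by (simp add: add_pos_nonneg)
      thus ?thesis using s y
        by (simp add: norm_inversion power_divide field_simps flip: s_def)
    qed
    finally have "(r / norm y) ^ (CARD('n) - 2) * (2 / ((norm (inversion r y))\<^sup>2 + 1)) powr m =
       (2 * r\<^sup>2 / ((norm y)\<^sup>2 + (r\<^sup>2)\<^sup>2)) powr m" .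
    thus ?thesis by (simp add: kelvin_def u_def stereo_inversion[OF r y])
  qed
  interpret kelvin_family u k k0
  proof
    show "DIM(real^'n) \<ge> 3" using dim by simp
    show "continuous_on UNIV u" by (rule contu)
    show "u x > 0" for x by (rule upos)
    show "k0 > 0" by (simp add: k0_def)
    show "\<bar>k x\<bar> \<le> k0" for x
      using B[of "stereo 1 1 x"] stereo_north_unit[of x] by (simp add: k_def k0_def)
    show "has_laplacian u (- k x * u x powr ((real DIM(real^'n) + 2) / (real DIM(real^'n) - 2))) x" for x
    proof -
      have "\<forall>\<^sub>F y in nhds x. stereo 1 1 y \<in> unit_sphere - {north}"
        by (intro always_eventually allI stereo_north_unit)
      from stereo_pullback_equation[OF dim _ _ v this] show ?thesis
        by (simp add: u_def k_def m_def n_def)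
    qed
    show "has_laplacian (kelvin u r)
      (- k (inversion r x) * kelvin u r x powr ((real DIM(real^'n) + 2) / (real DIM(real^'n) - 2))) x"
      if r: "r > 0" and x: "x \<noteq> 0" for r x
    proof -
      have ne: "\<forall>\<^sub>F y in nhds x. y \<noteq> 0" using x by (rule t1_space_nhds)
      hence U: "\<forall>\<^sub>F y in nhds x. stereo (r\<^sup>2) (- 1) y \<in> unit_sphere - {north}"
      proof eventually_elim
        case (elim y)
        show ?case unfolding stereo_inversion[OF r elim] by (rule stereo_north_unit)
      qed
      have "has_laplacian (\<lambda>y. (2 * r\<^sup>2 / ((norm y)\<^sup>2 + (r\<^sup>2)\<^sup>2)) powr m * v (stereo (r\<^sup>2) (- 1) y))
         (- k (inversion r x) * kelvin u r x powr ((real DIM(real^'n) + 2) / (real DIM(real^'n) - 2))) x"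
        using stereo_pullback_equation[OF dim _ _ v U] r
        by (simp add: kel[OF r x] k_def m_def n_def stereo_inversion[OF r x])
      thus ?thesis by (rule has_laplacian_cong) (use ne kel[OF r] in \<open>auto elim!: eventually_mono\<close>)
    qed
    show "k (inversion r x) \<le> k x" if "0 < r" "r \<le> norm x" for r x
    proof -
      have x: "x \<noteq> 0" using that by auto
      have "(r / norm x)\<^sup>2 \<le> 1" using that x by (intro power_le_one) auto
      from k_ray[OF x _ this] show ?thesis using that x by (simp add: inversion_def)
    qed
  qed
  have "continuous_on (cball 0 1) u" by (rule continuous_on_subset[OF contu]) simp
  from continuous_attains_inf[OF compact_cball _ this]
  obtain y where "\<forall>x\<in>cball 0 1. u y \<le> u x" by auto
  hence y: "\<And>x. norm x \<le> 1 \<Longrightarrow> u y \<le> u x" by simp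
  define c where "c = u y"
  have c: "c > 0" using upos by (simp add: c_def)
  have "v p \<ge> c * norm (p - north) powr (- m)" if pU: "p \<in> unit_sphere - {north}" for p
  proof -
    obtain x where p: "p = stereo 1 1 x" using stereo_surj[OF pU] .
    define q where "q = (norm x)\<^sup>2 + 1"
    have q: "q \<ge> 1" "q > 0" using qpos[of x] by (auto simp: q_def)
    have ux: "u x \<ge> c * q powr (- (m / 2))"
    proof (cases "norm x \<le> 1")
      case True
      have "q powr (- (m / 2)) \<le> 1" using powr_mono[of "- (m / 2)" 0 q] q m by simp
      hence "c * q powr (- (m / 2)) \<le> c" using c by (simp add: mult_left_le)
      thus ?thesis using y[OF True] by (simp add: c_def)
    next
      case False
      hence x1: "norm x \<ge> 1" "norm x > 0" by auto
      have "norm x powr (- m) = ((norm x)\<^sup>2) powr (- (m / 2))"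
      proof -
        have "(norm x)\<^sup>2 = norm x powr 2" using x1 by simp
        hence "((norm x)\<^sup>2) powr (- (m / 2)) = norm x powr (2 * (- (m / 2)))"
          by (simp only: powr_powr)
        thus ?thesis by simp
      qed
      also have "\<dots> \<ge> q powr (- (m / 2))"
        using x1 m by (intro powr_mono2') (auto simp: q_def)
      finally have "c * q powr (- (m / 2)) \<le> norm x powr (- m) * c"
        using c by (simp add: mult.commute)
      also have "\<dots> \<le> norm x powr (- m) * u ((1 / norm x) *\<^sub>R x)"
        unfolding c_def using x1 by (intro mult_left_mono y) auto
      also have "\<dots> \<le> u x" using decay_at_most_critical[OF nonconst x1(1)] by (simp add: m_def n_def)
      finally show ?thesis .
    qed
    have "v p = u x * (q / 2) powr m"
      using q by (simp add: u_def p powr_divide flip: q_def)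
    also have "\<dots> \<ge> (c * q powr (- (m / 2))) * (q / 2) powr m"
      using ux by (intro mult_right_mono) auto
    finally have "c * (q powr (- (m / 2)) * (q / 2) powr m) \<le> v p" by (simp only: mult.assoc)
    also have "q powr (- (m / 2)) * (q / 2) powr m = (2 / sqrt q) powr (- m)"
    proof -
      have "(2 / sqrt q) powr (- m) = sqrt q powr m / 2 powr m"
        using q by (simp add: powr_minus powr_divide)
      also have "sqrt q powr m = q powr (m / 2)" using q by (simp add: powr_powr flip: powr_half_sqrt)
      also have "q powr (m / 2) = q powr (- (m / 2)) * q powr m" by (simp flip: powr_add)
      finally show ?thesis using q by (simp add: powr_divide)
    qed
    finally show ?thesis using p norm_stereo_north[of x] by (simp add: q_def)
  qed
  thus ?thesis using c unfolding m_def n_def by blast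
qed

theorem theorem1p8:
  fixes K :: "(real^'n) \<times> real \<Rightarrow> real"
  assumes dim: "CARD('n) \<ge> 3"
    and K_C1: "C1_on_sphere unit_sphere K"
    and K_mono: "\<forall>p\<in>unit_sphere - {north, south}. sphere_deriv K p (meridian_field p) \<ge> 0"
    and K_nontrivial: "\<exists>p\<in>unit_sphere - {north, south}. sphere_deriv K p (meridian_field p) \<noteq> 0"
  shows "(\<forall>v. C2_on_sphere (unit_sphere - {north}) v \<longrightarrow>
              solves_on_punctured_sphere K v \<longrightarrow>
              Liminf (at north within unit_sphere) (\<lambda>p. ereal (v p)) > 0 \<longrightarrow>
              (\<exists>C0>0. \<forall>p\<in>unit_sphere - {north}.
                 v p \<ge> C0 * sphere_dist p north powr (- ((real CARD('n) - 2) / 2))))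
         \<and> \<not> (\<exists>v. C2_on_sphere unit_sphere v \<and> solves_on_punctured_sphere K v)"
proof (intro conjI allI impI notI)
  define m where "m = (real CARD('n) - 2) / 2"
  have m: "m > 0" using dim by (simp add: m_def)
  note bound = blow_up_in_chordal_distance[OF dim K_C1 K_mono K_nontrivial, folded m_def]
  {
    fix v assume v: "C2_on_sphere (unit_sphere - {north}) v" "solves_on_punctured_sphere K v"
    obtain c where c: "c > 0" "\<And>p. p \<in> unit_sphere - {north} \<Longrightarrow> v p \<ge> c * norm (p - north) powr (- m)"
      using bound[OF v] by blast
    have "v p \<ge> c * sphere_dist p north powr (- m)" if p: "p \<in> unit_sphere - {north}" for p
    proof -
      have "sphere_dist p north powr (- m) \<le> norm (p - north) powr (- m)"
        using p m chord_le_sphere_dist[of p] by (intro powr_mono2') auto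
      hence "c * sphere_dist p north powr (- m) \<le> c * norm (p - north) powr (- m)"
        using c(1) by simp
      thus ?thesis using c(2)[OF p] by linarith
    qed
    thus "\<exists>C0>0. \<forall>p\<in>unit_sphere - {north}.
        v p \<ge> C0 * sphere_dist p north powr (- ((real CARD('n) - 2) / 2))"
      using c(1) unfolding m_def by blast
  }
  assume "\<exists>v. C2_on_sphere unit_sphere v \<and> solves_on_punctured_sphere K v"
  then obtain v where v: "C2_on_sphere unit_sphere v" "solves_on_punctured_sphere K v" by blast
  have "C2_on_sphere (unit_sphere - {north}) v"
    using v(1) unfolding C2_on_sphere_def C1_on_sphere_def by (meson Diff_subset continuous_on_subset subsetD)
  then obtain c where c: "c > 0" "\<And>p. p \<in> unit_sphere - {north} \<Longrightarrow> v p \<ge> c * norm (p - north) powr (- m)"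
    using bound v(2) by blast
  have "bounded (v ` unit_sphere)"
    by (intro compact_imp_bounded compact_continuous_image C1_on_sphere_continuous)
       (use v(1) in \<open>auto simp: C2_on_sphere_def\<close>)
  then obtain B where B: "\<And>p. p \<in> unit_sphere \<Longrightarrow> \<bar>v p\<bar> \<le> B" by (fastforce simp: bounded_iff)
  define M where "M = \<bar>B\<bar> / c + 1"
  \<comment> \<open>a point \<open>2 / R\<close> away from the pole, where the lower bound for \<open>v\<close> is \<open>c M > B\<close>\<close>
  define R where "R = 2 * M powr (1 / m)"
  have M: "M \<ge> 1" using c(1) by (simp add: M_def)
  have R: "R \<ge> 2" using M m by (simp add: R_def ge_one_powr_ge_zero)
  obtain x :: "real^'n" where x: "norm x = sqrt (R\<^sup>2 - 1)"
    using vector_choose_size[of "sqrt (R\<^sup>2 - 1)"] R by (auto simp: power2_eq_square mult_ge1_I)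
  have "R\<^sup>2 \<ge> 1" using R by (simp add: one_le_power)
  hence "(norm x)\<^sup>2 + 1 = R\<^sup>2" using x by simp
  hence "norm (stereo 1 1 x - north) = 2 / R" using R by (simp add: norm_stereo_north)
  moreover have "(2 / R) powr (- m) = M"
  proof -
    have "2 / R = M powr (- (1 / m))" using M by (simp add: R_def powr_minus inverse_eq_divide)
    thus ?thesis using m M by (simp add: powr_powr)
  qed
  ultimately have "v (stereo 1 1 x) \<ge> c * M"
    using c(2)[OF stereo_north_unit[of x]] by simp
  moreover have "c * M > B" using c(1) by (simp add: M_def algebra_simps)
  ultimately show False using B[of "stereo 1 1 x"] stereo_north_unit[of x] by simp
qed

end
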